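(* Let $d,m\ge1$ be integers and let $U\subseteq\mathbb{R}^m$ be open and bounded. Suppose that $A_n\to A$ in $C^{0,1}(\overline U,\mathrm{Herm}(d))$ as $n\to\infty$. Set $\lambda_j:=\lambda_j^\uparrow\circ A$ and $\lambda_{n,j}:=\lambda_j^\uparrow\circ A_n$, for $1\le j\le d$. Then: (1) For $1\le j\le d$, $\mathrm{Area}(\lambda_{n,j})\to\mathrm{Area}(\lambda_j)$ as $n\to\infty$. (2) Let $Z:=\bigcup_{j=1}^d\overline{\lambda}_j(U)\subseteq U\times\mathbb{R}$, resp. $Z_n:=\bigcup_{j=1}^d\overline{\lambda}_{n,j}(U)$, be the total zero set of the characteristic polynomial of $A$, resp. $A_n$. Then $$\liminf_{n\to\infty}\mathcal{H}^m(Z_n)\ge\mathcal{H}^m(Z).$$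
   Context: $\mathrm{Herm}(d)$ is the space of complex Hermitian $d\times d$ matrices with the Frobenius norm $\|\cdot\|_2$, and $\lambda_1^\uparrow(B)\le\dots\le\lambda_d^\uparrow(B)$ are the increasingly ordered eigenvalues (with multiplicity) of $B\in\mathrm{Herm}(d)$. $C^{0,1}(\overline U,\mathrm{Herm}(d))$ carries the norm $\sup_{x\in U}\|f(x)\|_2+\sup_{x\ne y\in U}\frac{\|f(x)-f(y)\|_2}{\|x-y\|_2}$; the functions $\lambda_j,\lambda_{n,j}$ are Lipschitz on $U$. For a function $f:U\to\mathbb{R}$, $\overline f:U\to U\times\mathbb{R}$, $\overline f(x)=(x,f(x))$, is the graph mapping, and $\mathrm{Area}(f):=\mathcal{H}^m(\overline f(U))$ is the surface area of the graph, where $\mathcal{H}^m$ is $m$-dimensional Hausdorff measure. *)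

theory Defs
  imports "HOL-Analysis.Analysis" "HOL-Computational_Algebra.Polynomial"
begin

definition Herm :: "(complex^'d^'d) set" where
  "Herm = {B. \<forall>i j. B $ i $ j = cnj (B $ j $ i)}"

text \<open>The norm of the type \<^typ>\<open>complex^'d^'d\<close> is the Frobenius norm.\<close>

lemma norm_matrix_eq_Frobenius:
  "norm (B :: complex^'d^'d) = sqrt (\<Sum>i\<in>UNIV. \<Sum>j\<in>UNIV. (cmod (B $ i $ j))\<^sup>2)"
  by (simp add: norm_vec_def L2_set_def sum_nonneg)

definition charpoly :: "complex^'d^'d \<Rightarrow> complex poly" where
  "charpoly B = det (\<chi> i j. (if i = j then [:0, 1:] else 0) - [:B $ i $ j:])"

text \<open>
  The \<open>j\<close>-th smallest eigenvalue, \<open>1 \<le> j \<le> d\<close>, counted with multiplicity as a root of the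
  characteristic polynomial. It is meant for Hermitian \<open>B\<close>, whose eigenvalues are real, so that
  \<^const>\<open>Re\<close> merely changes their type.
\<close>

definition eigval_up :: "nat \<Rightarrow> complex^'d^'d \<Rightarrow> real" where
  "eigval_up j B =
     sorted_list_of_multiset (image_mset Re (proots (charpoly B))) ! (j - 1)"

text \<open>
  The norm of \<open>C\<^sup>0\<^sup>,\<^sup>1\<close> takes values in \<^typ>\<open>ennreal\<close>, so that it is \<open>\<infinity>\<close> on functions outside the
  space and both suprema are \<open>0\<close> if there is nothing to range over.
\<close>

definition C01_norm :: "'a::real_normed_vector set \<Rightarrow> ('a \<Rightarrow> 'b::real_normed_vector) \<Rightarrow> ennreal" where
  "C01_norm U f =
     (SUP x\<in>U. ennreal (norm (f x))) +
     (SUP (x, y)\<in>{(x, y). x \<in> U \<and> y \<in> U \<and> x \<noteq> y}. ennreal (norm (f x - f y) / norm (x - y)))"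

text \<open>
  \<open>C\<^sup>0\<^sup>,\<^sup>1\<close> on the closure of \<open>U\<close> with values in \<open>H\<close>; values outside the closure are irrelevant.
\<close>

definition C01 :: "'a::real_normed_vector set \<Rightarrow> 'b::real_normed_vector set \<Rightarrow> ('a \<Rightarrow> 'b) set" where
  "C01 U H = {f. f ` closure U \<subseteq> H \<and> continuous_on (closure U) f \<and> C01_norm U f < \<infinity>}"

text \<open>
  The \<open>m\<close>-dimensional Hausdorff measure, normalised to agree with Lebesgue measure on \<open>m\<close>-dimensional
  Euclidean space. The covering sets have to be bounded because \<^const>\<open>diameter\<close> is only
  meaningful for bounded sets. The case distinction on empty sets matters only for \<open>m = 0\<close>,
  since \<open>0 ^ 0 = 1\<close>.
\<close>

definition hausdorff_premeasure :: "nat \<Rightarrow> real \<Rightarrow> 'a::metric_space set \<Rightarrow> ennreal" where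
  "hausdorff_premeasure m \<delta> S =
     (INF C \<in> {C :: nat \<Rightarrow> 'a set.
                 S \<subseteq> (\<Union>i. C i) \<and> (\<forall>i. bounded (C i) \<and> diameter (C i) \<le> \<delta>)}.
        \<Sum>i. if C i = {} then 0
            else ennreal (unit_ball_vol (real m) * (diameter (C i) / 2) ^ m))"

definition hausdorff_measure :: "nat \<Rightarrow> 'a::metric_space set \<Rightarrow> ennreal" where
  "hausdorff_measure m S = (SUP \<delta>\<in>{0<..}. hausdorff_premeasure m \<delta> S)"

definition graph_map :: "('a \<Rightarrow> real) \<Rightarrow> 'a \<Rightarrow> 'a \<times> real" where
  "graph_map f x = (x, f x)"

text \<open>The metric of the product type \<open>(real^'m) \<times> real\<close> is the Euclidean one.\<close>

definition Area :: "(real^'m) set \<Rightarrow> (real^'m \<Rightarrow> real) \<Rightarrow> ennreal" where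
  "Area U f = hausdorff_measure CARD('m) (graph_map f ` U)"

end

theory Submission
  imports Defs
begin

text \<open>
  The gradients of the eigenvalues never appear: the only measure theory needed is that Hausdorff
  measure is finitely subadditive, scales by at most \<open>K ^ m\<close> under \<open>K\<close>-Lipschitz maps, and is bounded
  by a multiple of Lebesgue measure on open sets. Let \<open>E g\<close> be the set of points of \<open>U\<close> where any two
  eigenvalues of \<open>A\<close> are equal or at least \<open>g\<close> apart. As \<open>g\<close> tends to \<open>0\<close>, the open sets \<open>U - E g\<close>
  decrease to the empty set, so the graphs over them have small measure, uniformly in \<open>n\<close>. On \<open>E g\<close>
  the Lipschitz constant of \<open>\<lambda>\<^sub>n\<^sub>,\<^sub>j - \<lambda>\<^sub>j\<close> tends to \<open>0\<close>, so that the graphs of \<open>\<lambda>\<^sub>n\<^sub>,\<^sub>j\<close> and \<open>\<lambda>\<^sub>j\<close> over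
  \<open>E g\<close> are related by bi-Lipschitz maps with constants tending to \<open>1\<close>.

  The last claim is local perturbation theory. For nearby points \<open>x\<close>, \<open>y\<close> of \<open>E g\<close>, the matrices
  \<open>M = A(x) - \<lambda>\<^sub>j(x)\<close> and \<open>M' = A(y) - \<lambda>\<^sub>j(y)\<close> are uniformly bounded from below on their ranges, which
  gives a linear map \<open>S\<close> with \<open>S\<^sup>* M' S \<le> M\<close> and \<open>S - 1 = O(|x - y|)\<close>. Transporting by \<open>S\<close> the subspaces in
  the min-max characterisation of the \<open>j\<close>-th eigenvalue of \<open>A\<^sub>n\<close>, the only error terms are of order
  \<open>|x - y|\<close> times the \<open>C\<^sup>0\<^sup>,\<^sup>1\<close>-distance of \<open>A\<^sub>n\<close> and \<open>A\<close>.
\<close>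

section \<open>Self-adjoint operators bounded from below on their range\<close>

text \<open>\<open>Q\<close> is the orthogonal projection onto the range of \<open>M\<close>.\<close>

locale gapped_selfadjoint =
  fixes M Q :: "'a::real_inner \<Rightarrow> 'a" and g :: real
  assumes linM: "linear M" and linQ: "linear Q"
    and selfadjoint: "x \<bullet> M y = M x \<bullet> y"
    and symQ: "x \<bullet> Q y = Q x \<bullet> y"
    and idemQ [simp]: "Q (Q x) = Q x"
    and MQ [simp]: "M (Q x) = M x"
    and g_pos: "0 < g"
    and gap: "g * norm (Q x) \<le> norm (M x)"
begin

lemma norm_proj_le: "norm (Q x) \<le> norm x"
proof -
  have "norm (Q x) * norm (Q x) = x \<bullet> Q x"
    by (metis idemQ symQ dot_square_norm power2_eq_square)
  also have "\<dots> \<le> norm x * norm (Q x)" by (rule norm_cauchy_schwarz)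
  finally show ?thesis
    by (metis mult_le_cancel_right norm_not_less_zero norm_ge_zero order_le_less)
qed

lemma norm_coproj_le: "norm (x - Q x) \<le> norm x"
proof -
  have "Q x \<bullet> (x - Q x) = 0"
    by (metis idemQ inner_diff_right right_minus_eq symQ)
  then have "(norm x)\<^sup>2 = (norm (Q x))\<^sup>2 + (norm (x - Q x))\<^sup>2"
    by (simp add: power2_norm_eq_inner inner_diff_left inner_diff_right inner_commute)
  then show ?thesis by (metis abs_le_square_iff abs_norm_cancel le_add_same_cancel2 zero_le_power2)
qed

lemma M_coproj: "M (x - Q x) = 0"
  by (simp add: linear_diff[OF linM])

end

text \<open>On the kernel of \<open>M\<close> the operator \<open>M'\<close> equals
  \<open>M' - M\<close>, which is small, whereas the gap of \<open>M'\<close> bounds it from below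
  by the component in its range. The second bound exchanges the roles: \<open>Q x - Q' (Q x)\<close>
  lies in the kernel of \<open>M'\<close>.\<close>

lemma gapped_selfadjoint_proj_diff:
  assumes "gapped_selfadjoint M Q g" "gapped_selfadjoint M' Q' g"
    and diff: "\<And>x. norm (M x - M' x) \<le> \<delta> * norm x"
  shows "norm (Q' (x - Q x)) \<le> \<delta> / g * norm x"
    and "norm (Q x - Q' (Q x)) \<le> \<delta> / g * norm (Q x)"
proof -
  interpret A: gapped_selfadjoint M Q g by fact
  interpret B: gapped_selfadjoint M' Q' g by fact
  have "0 \<le> \<delta> \<or> norm x = 0"
    using diff[of x] by (smt (verit) mult_neg_pos norm_ge_zero)
  then have "\<delta> * norm (x - Q x) \<le> \<delta> * norm x"
    using A.norm_coproj_le[of x] by (auto simp: mult_left_mono linear_0[OF A.linQ])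
  then have "g * norm (Q' (x - Q x)) \<le> \<delta> * norm x"
    using B.gap[of "x - Q x"] diff[of "x - Q x"] by (simp add: A.M_coproj)
  then show "norm (Q' (x - Q x)) \<le> \<delta> / g * norm x"
    using A.g_pos by (simp add: field_simps)
  define v where "v = Q x - Q' (Q x)"
  have "g * norm (Q v) \<le> \<delta> * norm v"
    using A.gap[of v] diff[of v] by (simp add: B.M_coproj v_def)
  then have qv: "norm (Q v) \<le> \<delta> / g * norm v"
    using A.g_pos by (simp add: field_simps)
  \<comment> \<open>As \<open>v\<close> is orthogonal to \<open>Q' (Q x)\<close>, its squared norm
    is \<open>Q x \<bullet> v\<close>; moving \<open>Q\<close> onto \<open>v\<close> brings in the
    small factor.\<close>
  have "Q' (Q x) \<bullet> v = 0"
    unfolding v_def by (metis B.idemQ inner_diff_right right_minus_eq B.symQ)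
  then have "norm v * norm v = Q x \<bullet> v"
    by (simp add: v_def flip: power2_eq_square add: power2_norm_eq_inner inner_diff_left)
  also have "\<dots> = Q x \<bullet> Q v" by (metis A.idemQ A.symQ)
  also have "\<dots> \<le> norm (Q x) * norm (Q v)" by (rule norm_cauchy_schwarz)
  also have "\<dots> \<le> norm (Q x) * (\<delta> / g * norm v)" by (rule mult_left_mono[OF qv norm_ge_zero])
  finally have "norm v * norm v \<le> (\<delta> / g * norm (Q x)) * norm v" by (simp add: mult_ac)
  then show "norm (Q x - Q' (Q x)) \<le> \<delta> / g * norm (Q x)"
  proof (cases "norm v = 0")
    case True
    have "0 \<le> \<delta> \<or> norm (Q x) = 0"
      using diff[of "Q x"] by (smt (verit) mult_neg_pos norm_ge_zero)
    with True A.g_pos show ?thesis by (auto simp: v_def)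
  next
    case False
    then have "0 < norm v" by simp
    with \<open>norm v * norm v \<le> _\<close> show ?thesis unfolding v_def[symmetric]
      by (metis mult_le_cancel_right not_less_iff_gr_or_eq)
  qed
qed

text \<open>
  \<open>S = (1 - \<eta> M') Q' Q + (1 - Q') (1 - Q)\<close> maps the range and the kernel of \<open>M\<close> to those of \<open>M'\<close>. The
  factor \<open>1 - \<eta> M'\<close> lowers the form of \<open>M'\<close> by \<open>\<eta> M'\<^sup>2\<close>, at least a multiple of \<open>\<eta> g\<^sup>2\<close> on the range,
  which absorbs the error \<open>\<delta>\<close> made by replacing \<open>M\<close> with \<open>M'\<close>.
\<close>

lemma gapped_selfadjoint_transfer:
  assumes "gapped_selfadjoint M Q g" "gapped_selfadjoint M' Q' g"
    and diff: "\<And>x. norm (M x - M' x) \<le> \<delta> * norm x"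
    and bd: "\<And>x. norm (M' x) \<le> N * norm x"
    and "0 < N" "0 \<le> \<delta>" "\<delta> \<le> g / 2" "4 * N * \<delta> \<le> g\<^sup>2"
  obtains S where "linear S"
    and "\<And>x. norm (S x - x) \<le> (2 / g + 4 * N / g\<^sup>2) * \<delta> * norm x"
    and "\<And>x. S x \<bullet> M' (S x) \<le> x \<bullet> M x"
proof -
  interpret A: gapped_selfadjoint M Q g by fact
  interpret B: gapped_selfadjoint M' Q' g by fact
  note pd = gapped_selfadjoint_proj_diff[OF assms(1,2) diff]
  \<comment> \<open>With this choice the guaranteed loss \<open>\<eta> * g\<^sup>2 / 4\<close>
    equals \<delta>, and \<open>4 * N * \<delta> \<le> g\<^sup>2\<close> becomes
    \<open>\<eta> * N \<le> 1\<close>.\<close>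
  define \<eta> where "\<eta> = 4 * \<delta> / g\<^sup>2"
  have eta: "0 \<le> \<eta>" "\<eta> * N \<le> 1" "\<eta> * g\<^sup>2 / 4 = \<delta>"
    using assms A.g_pos by (auto simp: \<eta>_def field_simps)
  define S where "S x = (Q' (Q x) - \<eta> *\<^sub>R M' (Q' (Q x))) + ((x - Q x) - Q' (x - Q x))" for x
  show thesis
  proof (rule that)
    show "linear S"
      unfolding S_def
      by (rule linearI)
        (simp_all add: linear_add[OF A.linQ] linear_add[OF B.linQ] linear_add[OF B.linM]
          linear_diff[OF B.linQ] linear_cmul[OF A.linQ] linear_cmul[OF B.linQ] linear_cmul[OF B.linM] algebra_simps)
  next
    fix x
    have "S x - x = - (Q x - Q' (Q x)) - Q' (x - Q x) - \<eta> *\<^sub>R M' (Q' (Q x))"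
      by (simp add: S_def)
    then have "norm (S x - x) \<le> norm (Q x - Q' (Q x)) + norm (Q' (x - Q x)) + norm (\<eta> *\<^sub>R M' (Q' (Q x)))"
      by (smt (verit) norm_minus_cancel norm_triangle_ineq4)
    moreover have "norm (Q x - Q' (Q x)) \<le> \<delta> / g * norm x"
      using pd(2)[of x] A.norm_proj_le[of x] \<open>0 \<le> \<delta>\<close> A.g_pos
      by (smt (verit) divide_nonneg_pos mult_left_mono)
    moreover have "norm (\<eta> *\<^sub>R M' (Q' (Q x))) \<le> \<eta> * (N * norm x)"
    proof -
      have "norm (M' (Q' (Q x))) \<le> N * norm x"
        using bd[of "Q x"] A.norm_proj_le[of x] \<open>0 < N\<close> by (smt (verit) B.MQ mult_left_mono)
      then show ?thesis using eta(1) by (simp add: mult_left_mono)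
    qed
    moreover note pd(1)[of x]
    ultimately have "norm (S x - x) \<le> \<delta> / g * norm x + \<delta> / g * norm x + \<eta> * (N * norm x)" by linarith
    also have "\<dots> = (2 / g + 4 * N / g\<^sup>2) * \<delta> * norm x" by (simp add: \<eta>_def algebra_simps)
    finally show "norm (S x - x) \<le> (2 / g + 4 * N / g\<^sup>2) * \<delta> * norm x" .
  next
    fix x
    define u w where "u = Q x" and "w = Q' u"
    define z where "z = w - \<eta> *\<^sub>R M' w"
    \<comment> \<open>The kernel part of \<open>S x\<close> disappears under \<open>M'\<close>, so
      the form at \<open>S x\<close> is the form at \<open>z\<close>.\<close>
    have MS: "M' (S x) = M' z"
      by (simp add: S_def linear_add[OF B.linM] B.M_coproj z_def w_def u_def)
    have "S x \<bullet> M' (S x) = S x \<bullet> M' z" by (simp add: MS)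
    also have "\<dots> = M' (S x) \<bullet> z" by (rule B.selfadjoint)
    also have "\<dots> = z \<bullet> M' z" by (simp add: MS inner_commute)
    also have "\<dots> = w \<bullet> M' w - 2 * \<eta> * (norm (M' w))\<^sup>2 + \<eta>\<^sup>2 * (M' w \<bullet> M' (M' w))"
      using B.selfadjoint[of w "M' w"]
      by (simp add: z_def linear_diff[OF B.linM] linear_cmul[OF B.linM]
          power2_norm_eq_inner power2_eq_square[of \<eta>] algebra_simps)
    \<comment> \<open>Since \<open>\<eta> * N \<le> 1\<close>, the second-order term uses up at most
      half of the first-order decrease.\<close>
    also have "\<dots> \<le> w \<bullet> M' w - \<eta> * (norm (M' w))\<^sup>2"
    proof -
      have "M' w \<bullet> M' (M' w) \<le> norm (M' w) * norm (M' (M' w))" by (rule norm_cauchy_schwarz)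
      also have "\<dots> \<le> norm (M' w) * (N * norm (M' w))" by (rule mult_left_mono[OF bd norm_ge_zero])
      finally have "M' w \<bullet> M' (M' w) \<le> N * (norm (M' w))\<^sup>2"
        by (simp add: power2_eq_square mult_ac)
      then have "\<eta> * (M' w \<bullet> M' (M' w)) \<le> \<eta> * (N * (norm (M' w))\<^sup>2)"
        using eta(1) by (rule mult_left_mono)
      also have "\<dots> = (\<eta> * N) * (norm (M' w))\<^sup>2" by simp
      also have "\<dots> \<le> 1 * (norm (M' w))\<^sup>2" by (rule mult_right_mono[OF eta(2)]) simp
      finally have "\<eta> * (M' w \<bullet> M' (M' w)) \<le> (norm (M' w))\<^sup>2" by simp
      then have "\<eta> * (\<eta> * (M' w \<bullet> M' (M' w))) \<le> \<eta> * (norm (M' w))\<^sup>2"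
        using eta(1) by (rule mult_left_mono)
      then show ?thesis by (simp add: power2_eq_square mult_ac)
    qed
    also have "\<dots> \<le> w \<bullet> M' w - \<eta> * (g\<^sup>2 * (norm u)\<^sup>2 / 4)"
    proof -
      \<comment> \<open>As \<delta> is at most \<open>g / 2\<close>, the projection
        \<open>Q'\<close> keeps at least half of the norm of \<open>u\<close>, and the gap of
        \<open>M'\<close> applies to what is kept.\<close>
      have "norm (u - w) \<le> \<delta> / g * norm u" using pd(2)[of x] by (simp add: u_def w_def)
      also have "\<dots> \<le> 1 / 2 * norm u"
        using \<open>\<delta> \<le> g / 2\<close> A.g_pos by (intro mult_right_mono) (auto simp: field_simps)
      finally have "norm u / 2 \<le> norm w" using norm_triangle_ineq2[of u "u - w"] by simp
      then have "g * (norm u / 2) \<le> g * norm w" using A.g_pos by simp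
      also have "\<dots> \<le> norm (M' w)" using B.gap[of w] by (simp add: w_def)
      finally have "(g * (norm u / 2))\<^sup>2 \<le> (norm (M' w))\<^sup>2"
        using A.g_pos by (intro power_mono) auto
      then have "g\<^sup>2 * (norm u)\<^sup>2 / 4 \<le> (norm (M' w))\<^sup>2" by (simp add: power_mult_distrib power_divide)
      then show ?thesis using eta(1) by (metis diff_left_mono mult_left_mono)
    qed
    also have "\<dots> = u \<bullet> M' u - \<delta> * (norm u)\<^sup>2"
    proof -
      have "w \<bullet> M' w = u \<bullet> M' u"
        using B.selfadjoint[of w u] by (simp add: w_def inner_commute)
      moreover have "\<eta> * (g\<^sup>2 * (norm u)\<^sup>2 / 4) = \<delta> * (norm u)\<^sup>2" using eta(3) by (metis mult.assoc mult.commute times_divide_eq_right)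
      ultimately show ?thesis by simp
    qed
    also have "\<dots> \<le> u \<bullet> M u"
    proof -
      have "u \<bullet> (M' u - M u) \<le> norm u * norm (M' u - M u)" by (rule norm_cauchy_schwarz)
      also have "\<dots> \<le> norm u * (\<delta> * norm u)"
        using diff[of u] by (intro mult_left_mono) (auto simp: norm_minus_commute)
      finally show ?thesis by (simp add: inner_diff_right power2_eq_square mult_ac)
    qed
    also have "\<dots> = x \<bullet> M x"
      using A.selfadjoint[of u x] by (simp add: u_def inner_commute)
    finally show "S x \<bullet> M' (S x) \<le> x \<bullet> M x" .
  qed
qed

section \<open>Spectral theorem for Hermitian matrices\<close>

text \<open>A maximiser of the Rayleigh quotient on the unit sphere of \<open>W\<close> is an
  eigenvector: moving it in the direction of the residual \<open>N e - \<mu> *\<^sub>R e\<close>,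
  which lies in \<open>W\<close>, would otherwise increase the quotient to first order.\<close>

lemma Rayleigh_eigenvector:
  fixes N :: "'a::euclidean_space \<Rightarrow> 'a"
  assumes lin: "linear N" and sa: "\<And>x y. x \<bullet> N y = N x \<bullet> y"
    and W: "subspace W" "W \<noteq> {0}" and inv: "\<And>x. x \<in> W \<Longrightarrow> N x \<in> W"
  obtains e \<mu> where "e \<in> W" "norm e = 1" "N e = \<mu> *\<^sub>R e"
proof -
  obtain w where w: "w \<in> W" "w \<noteq> 0" using W subspace_0 by blast
  have "sgn w \<in> W \<inter> sphere 0 1"
    using w W(1) by (simp add: sgn_div_norm subspace_mul)
  moreover have "compact (W \<inter> sphere 0 1)"
    by (simp add: closed_Int_compact closed_subspace W)
  moreover have "continuous_on (W \<inter> sphere 0 1) (\<lambda>x. x \<bullet> N x)"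
    by (intro continuous_intros linear_continuous_on linear_linear[THEN iffD2] lin)
  ultimately obtain e where e: "e \<in> W" "norm e = 1"
      and max: "\<And>x. x \<in> W \<Longrightarrow> norm x = 1 \<Longrightarrow> x \<bullet> N x \<le> e \<bullet> N e"
    using continuous_attains_sup[of "W \<inter> sphere 0 1" "\<lambda>x. x \<bullet> N x"] by fastforce
  define \<mu> where "\<mu> = e \<bullet> N e"
  have q: "x \<bullet> N x \<le> \<mu> * (x \<bullet> x)" if "x \<in> W" for x
  proof (cases "x = 0")
    case True
    then show ?thesis by simp
  next
    case False
    have "(inverse (norm x) *\<^sub>R x) \<bullet> N (inverse (norm x) *\<^sub>R x) \<le> \<mu>"
      unfolding \<mu>_def using that False W(1) by (intro max) (auto simp: subspace_mul)
    then have "(x \<bullet> N x) / (norm x)\<^sup>2 \<le> \<mu>"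
      by (simp add: linear_cmul[OF lin] power2_eq_square divide_inverse mult_ac)
    then show ?thesis using False by (simp add: divide_le_eq power2_norm_eq_inner mult.commute)
  qed
  define r where "r = N e - \<mu> *\<^sub>R e"
  have rW: "r \<in> W" unfolding r_def using e W(1) inv by (simp add: subspace_diff subspace_mul)
  define K where "K = r \<bullet> N r - \<mu> * (r \<bullet> r)"
  have key: "2 * t * (r \<bullet> r) + t\<^sup>2 * K \<le> 0" for t
  proof -
    have "e + t *\<^sub>R r \<in> W" using e rW W(1) by (simp add: subspace_add subspace_mul)
    from q[OF this] have "(e + t *\<^sub>R r) \<bullet> (N e + t *\<^sub>R N r) \<le> \<mu> * ((e + t *\<^sub>R r) \<bullet> (e + t *\<^sub>R r))"
      by (simp add: linear_add[OF lin] linear_cmul[OF lin])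
    moreover have "e \<bullet> N e = \<mu>" "e \<bullet> e = 1" using e(2) by (simp_all add: \<mu>_def norm_eq_1)
    moreover have "e \<bullet> N r = r \<bullet> r + \<mu> * (e \<bullet> r)" "r \<bullet> N e = r \<bullet> r + \<mu> * (e \<bullet> r)"
      using sa[of e r] by (simp_all add: r_def inner_diff_left inner_diff_right inner_commute algebra_simps)
    ultimately show ?thesis
      by (simp add: K_def inner_add_left inner_add_right inner_commute[of r e] algebra_simps power2_eq_square)
  qed
  have "r \<bullet> r = 0"
  proof (rule ccontr)
    assume "r \<bullet> r \<noteq> 0"
    then have pos: "0 < r \<bullet> r" by simp
    \<comment> \<open>Small enough that the quadratic term cannot cancel the linear one.\<close>
    define t where "t = (r \<bullet> r) / (\<bar>K\<bar> + 1)"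
    have "0 < t" "t * \<bar>K\<bar> < r \<bullet> r" using pos by (auto simp: t_def field_simps)
    moreover have "2 * (r \<bullet> r) + t * K \<le> 0"
    proof -
      have "t * (2 * (r \<bullet> r) + t * K) \<le> 0" using key[of t] by (simp add: algebra_simps power2_eq_square)
      then show ?thesis using \<open>0 < t\<close> by (simp add: mult_le_0_iff)
    qed
    moreover have "- (t * \<bar>K\<bar>) \<le> t * K"
      using \<open>0 < t\<close> by (metis abs_ge_minus_self abs_mult abs_of_pos minus_le_iff)
    ultimately show False using pos by linarith
  qed
  then have "N e = \<mu> *\<^sub>R e" by (simp add: r_def)
  with e show thesis by (rule that)
qed

text \<open>The Hermitian inner product, conjugate linear in the first argument. The real inner
  product of the type is its real part; an orthonormal basis over the complex numbers needs the
  stronger complex orthogonality.\<close>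

definition cip :: "complex^'d \<Rightarrow> complex^'d \<Rightarrow> complex" where
  "cip x y = (\<Sum>i\<in>UNIV. cnj (x $ i) * y $ i)"

lemma Re_cip: "Re (cip x y) = x \<bullet> y"
  by (simp add: cip_def inner_vec_def inner_complex_def)

lemma cip_self: "cip x x = of_real ((norm x)\<^sup>2)"
proof (rule complex_eqI)
  show "Re (cip x x) = Re (of_real ((norm x)\<^sup>2))" by (simp add: Re_cip power2_norm_eq_inner)
qed (simp add: cip_def)

lemma cip_add_right: "cip x (y + z) = cip x y + cip x z"
  by (simp add: cip_def sum.distrib distrib_left)

lemma cip_diff_right: "cip x (y - z) = cip x y - cip x z"
  by (simp add: cip_def sum_subtractf right_diff_distrib)

lemma cip_scale_right: "cip x (c *s y) = c * cip x y"
  by (simp add: cip_def sum_distrib_left mult.left_commute)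

lemma cip_zero_right [simp]: "cip x 0 = 0"
  by (simp add: cip_def)

lemma cip_sum_right: "cip x (\<Sum>k\<in>K. f k) = (\<Sum>k\<in>K. cip x (f k))"
  by (induction K rule: infinite_finite_induct) (simp_all add: cip_add_right)

lemma cip_commute: "cip x y = cnj (cip y x)"
  by (simp add: cip_def mult.commute)

definition adjm :: "complex^'d^'d \<Rightarrow> complex^'d^'d" where
  "adjm P = (\<chi> i j. cnj (P $ j $ i))"

lemma cip_adjm: "cip x (P *v y) = cip (adjm P *v x) y"
proof -
  have "cip x (P *v y) = (\<Sum>i\<in>UNIV. \<Sum>j\<in>UNIV. cnj (x $ i) * (P $ i $ j * y $ j))"
    by (simp add: cip_def matrix_vector_mult_def sum_distrib_left)
  also have "\<dots> = (\<Sum>j\<in>UNIV. \<Sum>i\<in>UNIV. cnj (x $ i) * (P $ i $ j * y $ j))"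
    by (rule sum.swap)
  also have "\<dots> = cip (adjm P *v x) y"
    by (simp add: cip_def adjm_def matrix_vector_mult_def sum_distrib_right) (simp only: mult_ac)
  finally show ?thesis .
qed

lemma inner_adjm: "x \<bullet> (P *v y) = (adjm P *v x) \<bullet> y"
  using arg_cong[OF cip_adjm[of x P y], of Re] by (simp only: Re_cip)

lemma adjm_Herm:
  assumes "B \<in> Herm"
  shows "adjm B = B"
proof -
  have "B $ i $ j = cnj (B $ j $ i)" for i j using assms unfolding Herm_def by blast
  then show ?thesis unfolding adjm_def vec_eq_iff vec_lambda_beta by metis
qed

lemma cip_Herm: "B \<in> Herm \<Longrightarrow> cip x (B *v y) = cip (B *v x) y"
  by (simp add: cip_adjm adjm_Herm)

lemma inner_Herm: "B \<in> Herm \<Longrightarrow> x \<bullet> (B *v y) = (B *v x) \<bullet> (y :: complex^'d)"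
  by (simp add: inner_adjm adjm_Herm)

lemma scaleR_eq_scale: "r *\<^sub>R (x :: complex^'d) = complex_of_real r *s x"
  unfolding vec_eq_iff vector_scaleR_component vector_smult_component
  by (simp add: scaleR_conv_of_real)

text \<open>Induction on the number of eigenvectors: the complex orthogonal complement of those
  found so far is invariant under \<open>B\<close>, and nonzero while they are fewer than the
  dimension, so it contains another one. Its eigenvalue is real because the Rayleigh argument runs
  in the underlying real space.\<close>

lemma Herm_orthonormal_eigenvectors:
  fixes B :: "complex^'d^'d"
  assumes B: "B \<in> Herm"
  shows "k \<le> CARD('d) \<Longrightarrow> \<exists>e \<mu>. (\<forall>i<k. B *v e i = of_real (\<mu> i) *s e i) \<and>
     (\<forall>i<k. \<forall>j<k. cip (e i) (e j) = (if i = j then 1 else 0))"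
proof (induction k)
  case 0
  then show ?case by simp
next
  case (Suc k)
  then obtain e \<mu> where e: "\<And>i. i < k \<Longrightarrow> B *v e i = of_real (\<mu> i) *s e i"
    "\<And>i j. i < k \<Longrightarrow> j < k \<Longrightarrow> cip (e i) (e j) = (if i = j then 1 else 0)" by auto
  define W where "W = {x :: complex^'d. \<forall>i<k. cip (e i) x = 0}"
  have "vec.dim (e ` {..<k}) \<le> card (e ` {..<k})" by (rule vec.dim_le_card') simp
  also have "\<dots> \<le> k" using card_image_le[of "{..<k}" e] by simp
  finally have "vec.dim (e ` {..<k}) < CARD('d)" using Suc.prems by simp
  then have "vec.span (e ` {..<k}) \<noteq> UNIV"
    by (metis vec.dim_span vec_dim_card nat_neq_iff)
  then obtain x where x: "x \<notin> vec.span (e ` {..<k})" by blast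
  \<comment> \<open>The Gram-Schmidt residual of a vector outside the span witnesses that the
    complement is nonzero.\<close>
  define y where "y = x - (\<Sum>i<k. cip (e i) x *s e i)"
  have "(\<Sum>i<k. cip (e i) x *s e i) \<in> vec.span (e ` {..<k})"
    by (intro vec.span_sum vec.span_scale vec.span_base) auto
  with x have "y \<noteq> 0" by (auto simp: y_def)
  moreover have "y \<in> W"
    unfolding W_def y_def
    by (auto simp: cip_diff_right cip_sum_right cip_scale_right e(2) if_distrib[of "(*) _"] cong: if_cong)
  ultimately have "W \<noteq> {0}" by blast
  moreover have "subspace W"
    unfolding subspace_def W_def by (simp add: cip_add_right scaleR_eq_scale cip_scale_right)
  moreover have "B *v x \<in> W" if "x \<in> W" for x
    using that by (auto simp: W_def cip_Herm[OF B] e(1) cip_commute[of "_ *s _"] cip_scale_right)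
      (metis cip_commute complex_cnj_zero)
  ultimately obtain f \<nu> where f: "f \<in> W" "norm f = 1" "B *v f = \<nu> *\<^sub>R f"
    using Rayleigh_eigenvector[OF matrix_vector_mul_linear inner_Herm[OF B], of W] by metis
  have 1: "cip (e i) f = 0" "cip f (e i) = 0" if "i < k" for i
    using f(1) that cip_commute[of f "e i"] by (auto simp: W_def)
  show ?case
    by (rule exI[of _ "e(k := f)"], rule exI[of _ "\<mu>(k := \<nu>)"])
      (use e f 1 in \<open>auto simp: less_Suc_eq scaleR_eq_scale cip_self\<close>)
qed

definition diagm :: "('d \<Rightarrow> 'a::zero) \<Rightarrow> 'a^'d^'d" where
  "diagm \<mu> = (\<chi> i j. if i = j then \<mu> i else 0)"

lemma Herm_diagonalize:
  fixes B :: "complex^'d^'d"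
  assumes "B \<in> Herm"
  obtains P :: "complex^'d^'d" and \<mu> :: "'d \<Rightarrow> real"
  where "adjm P ** P = mat 1" "B ** P = P ** diagm (\<lambda>i. of_real (\<mu> i))"
proof -
  obtain e \<mu> where e: "\<And>i. i < CARD('d) \<Longrightarrow> B *v e i = of_real (\<mu> i) *s e i"
    "\<And>i j. i < CARD('d) \<Longrightarrow> j < CARD('d) \<Longrightarrow> cip (e i) (e j) = (if i = j then 1 else 0)"
    using Herm_orthonormal_eigenvectors[OF assms order_refl] by blast
  obtain h :: "'d \<Rightarrow> nat" where h: "bij_betw h UNIV {..<CARD('d)}"
    using ex_bij_betw_finite_nat[of "UNIV :: 'd set"] by (auto simp: atLeast0LessThan)
  have hl: "h i < CARD('d)" for i using h by (auto simp: bij_betw_def)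
  have hi: "h i = h j \<longleftrightarrow> i = j" for i j using h by (auto simp: bij_betw_def inj_on_def)
  define P where "P = (\<chi> i j. e (h j) $ i)"
  show thesis
  proof (rule that)
    have "(adjm P ** P) $ i $ j = cip (e (h i)) (e (h j))" for i j
      by (simp add: adjm_def P_def matrix_matrix_mult_def cip_def)
    then show "adjm P ** P = mat 1" by (simp add: vec_eq_iff mat_def e(2) hl hi)
    have "(B ** P) $ i $ j = (B *v e (h j)) $ i" for i j
      by (simp add: P_def matrix_matrix_mult_def matrix_vector_mult_def)
    then show "B ** P = P ** diagm (\<lambda>i. of_real (\<mu> (h i)))"
      by (simp add: vec_eq_iff e(1) hl P_def matrix_matrix_mult_def diagm_def if_distrib[of "(*) _"] mult.commute cong: if_cong)
  qed
qed

text \<open>Conjugation by \<open>P\<close> takes place over the ring of polynomials, where matrices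
  of constants commute with the scalar matrix \<open>X\<close>. This ring is not a field, so
  \<open>det (C P)\<close> is cancelled by means of its explicit inverse
  \<open>det (C R)\<close>.\<close>

lemma charpoly_similar:
  fixes B P R :: "complex^'d^'d"
  assumes "R ** P = mat 1" "B ** P = P ** diagm \<mu>"
  shows "charpoly B = (\<Prod>i\<in>UNIV. [:- \<mu> i, 1:])"
proof -
  define C :: "complex^'d^'d \<Rightarrow> complex poly^'d^'d" where "C M = (\<chi> i j. [:M $ i $ j:])" for M
  define X :: "complex poly^'d^'d" where "X = diagm (\<lambda>i. [:0, 1:])"
  have poly_sum_const: "(\<Sum>k\<in>K. [:f k:]) = [:sum f K:]" for f :: "'d \<Rightarrow> complex" and K
    by (induction K rule: infinite_finite_induct) simp_all
  have C_mult: "C (M ** N) = C M ** C N" for M N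
    by (simp add: C_def matrix_matrix_mult_def vec_eq_iff poly_sum_const[symmetric] mult.commute)
  have XC: "X ** C M = C M ** X" for M
    by (simp add: C_def X_def diagm_def matrix_matrix_mult_def vec_eq_iff
        if_distrib[of "(*) _"] if_distrib[of "\<lambda>x. x * _"] if_distrib[of "smult _"] cong: if_cong)
  have ch: "charpoly M = det (X - C M)" for M
    unfolding charpoly_def by (rule arg_cong[where f = det]) (simp add: X_def C_def diagm_def vec_eq_iff)
  have "C (mat 1) = mat 1" by (simp add: C_def mat_def vec_eq_iff)
  then have "det (C R) * det (C P) = 1" by (metis C_mult assms(1) det_I det_mul)
  moreover have diff_left: "(M - N) ** K = M ** K - N ** K" and diff_right: "K ** (M - N) = K ** M - K ** N"
    for M N K :: "complex poly^'d^'d"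
    by (simp_all add: matrix_matrix_mult_def vec_eq_iff left_diff_distrib right_diff_distrib sum_subtractf)
  have "(X - C B) ** C P = C P ** (X - C (diagm \<mu>))"
    using XC[of P] C_mult[of B P] C_mult[of P "diagm \<mu>"]
    by (simp add: diff_right diff_left assms(2))
  then have "det (X - C B) * det (C P) = det (C P) * det (X - C (diagm \<mu>))" by (metis det_mul)
  moreover have "x = y" if "r * p = 1" "x * p = p * y" for r p x y :: "complex poly"
  proof -
    have "x = r * p * x" by (simp add: that(1))
    also have "\<dots> = r * (x * p)" by (simp only: mult_ac)
    also have "\<dots> = r * p * y" by (simp only: that(2) mult.assoc)
    finally show ?thesis by (simp add: that(1))
  qed
  ultimately have "det (X - C B) = det (X - C (diagm \<mu>))" by blast
  also have "\<dots> = (\<Prod>i\<in>UNIV. [:- \<mu> i, 1:])"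
    by (subst det_diagonal) (simp_all add: X_def C_def diagm_def)
  finally show ?thesis by (simp add: ch)
qed

text \<open>Links the sorted root list behind \<open>eigval_up\<close> with eigenvectors indexed by
  the type \<open>'d\<close>: \<open>\<sigma> i\<close> is the rank of the eigenvalue belonging to
  column \<open>i\<close> of \<open>P\<close>.\<close>

lemma Herm_spectral:
  fixes B :: "complex^'d^'d"
  assumes "B \<in> Herm"
  obtains P :: "complex^'d^'d" and \<sigma> :: "'d \<Rightarrow> nat"
  where "adjm P ** P = mat 1" "bij_betw \<sigma> UNIV {1..CARD('d)}"
    "B ** P = P ** diagm (\<lambda>i. of_real (eigval_up (\<sigma> i) B))"
    "\<And>i j. 1 \<le> i \<Longrightarrow> i \<le> j \<Longrightarrow> j \<le> CARD('d) \<Longrightarrow> eigval_up i B \<le> eigval_up j B"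
proof -
  obtain P :: "complex^'d^'d" and \<mu> where P: "adjm P ** P = mat 1" "B ** P = P ** diagm (\<lambda>i. of_real (\<mu> i))"
    using Herm_diagonalize[OF assms] .
  obtain xs0 :: "'d list" where xs0: "set xs0 = UNIV" "distinct xs0"
    using finite_distinct_list[of "UNIV :: 'd set"] by auto
  \<comment> \<open>Sorting the indices rather than the eigenvalues keeps the correspondence
    bijective when eigenvalues repeat.\<close>
  define xs where "xs = sort_key \<mu> xs0"
  have xs: "set xs = UNIV" "distinct xs" "sorted (map \<mu> xs)" using xs0 by (auto simp: xs_def)
  have len: "length xs = CARD('d)" using distinct_card[OF xs(2)] xs(1) by simp
  have sing: "(\<Sum>i\<in>K. {#f i#}) = image_mset f (mset_set K)" if "finite K" for f :: "'d \<Rightarrow> complex" and K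
    using that by induction simp_all
  have "proots (charpoly B) = (\<Sum>i\<in>UNIV. {#of_real (\<mu> i)#})"
    unfolding charpoly_similar[OF P] by (subst proots_prod) (simp_all add: proots_linear_factor[of "- _", simplified])
  then have "image_mset Re (proots (charpoly B)) = image_mset \<mu> (mset_set UNIV)"
    by (simp add: sing image_mset.compositionality o_def)
  also have "\<dots> = mset (map \<mu> xs)" using mset_set_set[OF xs(2)] by (simp add: xs(1))
  finally have L: "eigval_up j B = map \<mu> xs ! (j - 1)" for j
    unfolding eigval_up_def by (metis sorted_list_of_multiset_mset sorted_sort_id xs(3))
  \<comment> \<open>List positions start at 0, the numbering of the eigenvalues at 1.\<close>
  define \<sigma> where "\<sigma> i = Suc (inv_into {..<CARD('d)} ((!) xs) i)" for i
  have bij: "bij_betw ((!) xs) {..<CARD('d)} UNIV" using bij_betw_nth[OF xs(2)] len xs(1) by auto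
  then have "bij_betw (inv_into {..<CARD('d)} ((!) xs)) UNIV {..<CARD('d)}" by (rule bij_betw_inv_into)
  moreover have "bij_betw Suc {..<CARD('d)} {1..CARD('d)}"
    by (simp add: bij_betw_def image_Suc_lessThan)
  ultimately have s: "bij_betw \<sigma> UNIV {1..CARD('d)}"
    unfolding \<sigma>_def using bij_betw_trans[unfolded o_def] by blast
  have "eigval_up (\<sigma> i) B = \<mu> i" for i
  proof -
    have "inv_into {..<CARD('d)} ((!) xs) i < CARD('d)" "xs ! inv_into {..<CARD('d)} ((!) xs) i = i"
      using bij inv_into_into[of i "(!) xs" "{..<CARD('d)}"] f_inv_into_f[of i "(!) xs" "{..<CARD('d)}"]
      by (auto simp: bij_betw_def)
    then show ?thesis by (simp add: L \<sigma>_def len)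
  qed
  with P have 2: "B ** P = P ** diagm (\<lambda>i. of_real (eigval_up (\<sigma> i) B))" by simp
  have "eigval_up i B \<le> eigval_up j B" if "1 \<le> i" "i \<le> j" "j \<le> CARD('d)" for i j
    unfolding L using that len by (intro sorted_nth_mono[OF xs(3)]) auto
  with P(1) s 2 show thesis by (rule that)
qed

section \<open>Min-max characterisation of the eigenvalues\<close>

lemma diagm_vec [simp]: "(diagm \<mu> *v y) $ i = \<mu> i * y $ i"
  by (simp add: diagm_def matrix_vector_mult_def if_distrib[of "\<lambda>x. x * _"] cong: if_cong)

lemma norm_matrix_vector_le: "norm (B *v (x :: complex^'d)) \<le> norm (B :: complex^'d^'d) * norm x"
proof -
  have "norm ((B *v x) $ i) \<le> norm (B $ i) * norm x" for i
  proof -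
    have "norm ((B *v x) $ i) \<le> (\<Sum>j\<in>UNIV. norm (B $ i $ j) * norm (x $ j))"
      unfolding matrix_vector_mult_def by (simp flip: norm_mult) (rule sum_norm_le, simp)
    also have "\<dots> \<le> norm (B $ i) * norm x"
      using L2_set_mult_ineq[of "\<lambda>j. norm (B $ i $ j)" "\<lambda>j. norm (x $ j)" UNIV] by (simp add: norm_vec_def)
    finally show ?thesis .
  qed
  then have "L2_set (\<lambda>i. norm ((B *v x) $ i)) UNIV \<le> L2_set (\<lambda>i. norm (B $ i) * norm x) UNIV"
    by (intro L2_set_mono) auto
  then show ?thesis by (simp add: norm_vec_def[of "B *v x"] norm_vec_def[of B] L2_set_left_distrib)
qed

text \<open>All dimensions are real ones, hence twice the complex ones.\<close>

lemma dim_coordinate_subspace: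
  "dim {y :: complex^'d. \<forall>i. i \<notin> J \<longrightarrow> y $ i = 0} = 2 * card J"
proof -
  let ?D = "(\<Union>i\<in>J. {axis i 1, axis i \<i>}) :: (complex^'d) set"
  have sub: "?D \<subseteq> Basis" by (auto simp: Basis_vec_def Basis_complex_def)
  have "{y :: complex^'d. \<forall>i. i \<notin> J \<longrightarrow> y $ i = 0} = {x. \<forall>i\<in>Basis. i \<notin> ?D \<longrightarrow> x \<bullet> i = 0}"
    by (auto simp: Basis_vec_def Basis_complex_def inner_axis inner_complex_def complex_eq_iff axis_eq_axis)
  then have "dim {y :: complex^'d. \<forall>i. i \<notin> J \<longrightarrow> y $ i = 0} = card ?D" using dim_substandard[OF sub] by simp
  also have "\<dots> = (\<Sum>i\<in>J. card {axis i 1, axis i \<i> :: complex^'d})"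
    by (rule card_UN_disjoint) (auto simp: axis_eq_axis)
  also have "\<dots> = 2 * card J" by (simp add: axis_eq_axis)
  finally show ?thesis .
qed

text \<open>The output of the spectral theorem as a context: the columns of \<open>P\<close> form an
  orthonormal eigenbasis, and \<sigma> ranks them by eigenvalue.\<close>

locale unitary_eigenbasis =
  fixes B P :: "complex^'d^'d" and \<sigma> :: "'d \<Rightarrow> nat"
  assumes unitary: "adjm P ** P = mat 1" and bij: "bij_betw \<sigma> UNIV {1..CARD('d)}"
    and diag: "B ** P = P ** diagm (\<lambda>i. of_real (eigval_up (\<sigma> i) B))"
    and mono: "1 \<le> i \<Longrightarrow> i \<le> j \<Longrightarrow> j \<le> CARD('d) \<Longrightarrow> eigval_up i B \<le> eigval_up j B"
begin

lemma adjm_P [simp]: "adjm P *v (P *v y) = y"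
  by (simp add: matrix_vector_mul_assoc unitary)

lemma P_adjm [simp]: "P *v (adjm P *v y) = y"
  using unitary matrix_left_right_inverse[of "adjm P" P] by (simp add: matrix_vector_mul_assoc)

lemma inner_P: "(P *v y) \<bullet> (P *v z) = y \<bullet> z"
  by (simp add: inner_adjm)

lemma norm_P [simp]: "norm (P *v y) = norm y"
  by (simp add: norm_eq_sqrt_inner inner_P)

lemma B_P: "B *v (P *v y) = P *v (diagm (\<lambda>i. of_real (eigval_up (\<sigma> i) B)) *v y)"
  by (simp add: matrix_vector_mul_assoc diag)

lemma sigma_range: "\<sigma> i \<in> {1..CARD('d)}"
  using bij by (auto simp: bij_betw_def)

lemma quadratic_form:
  "(P *v y) \<bullet> (B *v (P *v y)) = (\<Sum>i\<in>UNIV. eigval_up (\<sigma> i) B * (norm (y $ i))\<^sup>2)"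
  unfolding B_P inner_P
  by (simp add: inner_vec_def inner_complex_def cmod_power2 algebra_simps power2_eq_square[of "Re _"] power2_eq_square[of "Im _"])

lemma inner_self: "(P *v y) \<bullet> (P *v y) = (\<Sum>i\<in>UNIV. (norm (y $ i))\<^sup>2)"
  unfolding inner_P
  by (simp add: inner_vec_def dot_square_norm)

text \<open>Selecting eigenvectors by rank rather than by eigenvalue gives real dimension
  \<open>2 * card J\<close> even when eigenvalues coincide.\<close>

definition eigspan :: "nat set \<Rightarrow> (complex^'d) set" where
  "eigspan J = (*v) P ` {y. \<forall>i. i \<notin> \<sigma> -` J \<longrightarrow> y $ i = 0}"

lemma subspace_eigspan: "subspace (eigspan J)"
  unfolding eigspan_def
  by (rule linear_subspace_image) (auto simp: subspace_def)

lemma dim_eigspan: "J \<subseteq> {1..CARD('d)} \<Longrightarrow> dim (eigspan J) = 2 * card J"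
proof -
  assume J: "J \<subseteq> {1..CARD('d)}"
  have "inj ((*v) P)" by (metis adjm_P injI)
  then have "dim (eigspan J) = dim {y :: complex^'d. \<forall>i. i \<notin> \<sigma> -` J \<longrightarrow> y $ i = 0}"
    unfolding eigspan_def by (intro dim_image_eq) (auto intro: inj_on_subset)
  also have "\<dots> = 2 * card (\<sigma> -` J)" by (rule dim_coordinate_subspace)
  also have "card (\<sigma> -` J) = card J"
    using bij J by (intro card_vimage_inj) (auto simp: bij_betw_def)
  finally show ?thesis .
qed

lemma eigspan_le:
  assumes "x \<in> eigspan J" "\<And>i. i \<in> J \<Longrightarrow> i \<in> {1..CARD('d)} \<Longrightarrow> eigval_up i B \<le> s"
  shows "x \<bullet> (B *v x) \<le> s * (x \<bullet> x)"
proof -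
  obtain y where y: "x = P *v y" "\<And>i. \<sigma> i \<notin> J \<Longrightarrow> y $ i = 0" using assms(1) by (auto simp: eigspan_def)
  have "eigval_up (\<sigma> i) B * (norm (y $ i))\<^sup>2 \<le> s * (norm (y $ i))\<^sup>2" for i
    using assms(2)[of "\<sigma> i"] y(2)[of i] sigma_range[of i] by (cases "\<sigma> i \<in> J") (auto intro: mult_right_mono)
  then show ?thesis unfolding y(1) quadratic_form inner_self sum_distrib_left by (rule sum_mono)
qed

lemma eigspan_ge:
  assumes "x \<in> eigspan J" "\<And>i. i \<in> J \<Longrightarrow> i \<in> {1..CARD('d)} \<Longrightarrow> s \<le> eigval_up i B"
  shows "s * (x \<bullet> x) \<le> x \<bullet> (B *v x)"
proof -
  obtain y where y: "x = P *v y" "\<And>i. \<sigma> i \<notin> J \<Longrightarrow> y $ i = 0" using assms(1) by (auto simp: eigspan_def)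
  have "s * (norm (y $ i))\<^sup>2 \<le> eigval_up (\<sigma> i) B * (norm (y $ i))\<^sup>2" for i
    using assms(2)[of "\<sigma> i"] y(2)[of i] sigma_range[of i] by (cases "\<sigma> i \<in> J") (auto intro: mult_right_mono)
  then show ?thesis unfolding y(1) quadratic_form inner_self sum_distrib_left by (rule sum_mono)
qed

text \<open>In the eigenbasis both operators are diagonal: \<open>Q\<close> discards the
  eigenvectors with eigenvalue \<open>a\<close>, and on the others the shifted eigenvalues are at
  least \<open>g\<close> in absolute value.\<close>

lemma gapped_selfadjoint_eigval:
  assumes "0 < g" and gap: "\<And>i. i \<in> {1..CARD('d)} \<Longrightarrow> eigval_up i B = a \<or> g \<le> \<bar>eigval_up i B - a\<bar>"
  shows "\<exists>Q. gapped_selfadjoint (\<lambda>x. B *v x - a *\<^sub>R x) Q g"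
proof -
  define R :: "complex^'d^'d" where "R = diagm (\<lambda>i. if eigval_up (\<sigma> i) B = a then 0 else 1)"
  define D :: "complex^'d^'d" where "D = diagm (\<lambda>i. of_real (eigval_up (\<sigma> i) B - a))"
  define Q where "Q x = P *v (R *v (adjm P *v x))" for x
  have MD: "B *v x - a *\<^sub>R x = P *v (D *v (adjm P *v x))" for x
  proof -
    have "B *v x - a *\<^sub>R x = B *v (P *v (adjm P *v x)) - P *v (a *\<^sub>R (adjm P *v x))"
      by (simp add: linear_cmul[OF matrix_vector_mul_linear])
    also have "\<dots> = P *v (D *v (adjm P *v x))"
      unfolding B_P matrix_vector_mult_diff_distrib[symmetric]
      by (rule arg_cong[where f = "(*v) P"])
        (simp add: vec_eq_iff D_def left_diff_distrib flip: scaleR_conv_of_real)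
    finally show ?thesis .
  qed
  have inner_diag: "u \<bullet> (diagm (\<lambda>i. of_real (\<mu> i)) *v v) = (diagm (\<lambda>i. of_real (\<mu> i)) *v u) \<bullet> v"
    for \<mu> :: "'d \<Rightarrow> real" and u v :: "complex^'d"
    by (simp add: inner_vec_def inner_complex_def algebra_simps)
  have P_left: "(P *v u) \<bullet> v = u \<bullet> (adjm P *v v)" for u v
    by (metis inner_P P_adjm)
  have R: "R = diagm (\<lambda>i. of_real (if eigval_up (\<sigma> i) B = a then 0 else 1))"
    unfolding R_def by (rule arg_cong[where f = diagm]) auto
  have RR: "R *v (R *v y) = R *v y" and DR: "D *v (R *v y) = D *v y" for y
    by (auto simp: vec_eq_iff R_def D_def)
  have "gapped_selfadjoint (\<lambda>x. B *v x - a *\<^sub>R x) Q g"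
  proof (rule gapped_selfadjoint.intro)
    show "linear (\<lambda>x. B *v x - a *\<^sub>R x)"
      by (intro linear_compose_sub matrix_vector_mul_linear linear_scale_self)
    show "linear Q"
      unfolding Q_def matrix_vector_mul_assoc by (rule matrix_vector_mul_linear)
    fix x y
    show "x \<bullet> (B *v y - a *\<^sub>R y) = (B *v x - a *\<^sub>R x) \<bullet> y"
      unfolding MD inner_adjm[of x P] P_left D_def by (rule inner_diag)
    show "x \<bullet> Q y = Q x \<bullet> y"
      unfolding Q_def inner_adjm[of x P] P_left R by (rule inner_diag)
    show "Q (Q x) = Q x" by (simp add: Q_def RR)
    show "B *v (Q x) - a *\<^sub>R (Q x) = B *v x - a *\<^sub>R x"
      unfolding MD by (simp add: Q_def DR)
    show "0 < g" by fact
    have "norm (g *\<^sub>R (R *v y)) \<le> norm (D *v y)" for y :: "complex^'d"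
    proof (rule norm_le_componentwise_cart)
      fix i
      show "norm ((g *\<^sub>R (R *v y)) $ i) \<le> norm ((D *v y) $ i)"
        using gap[OF sigma_range, of i] \<open>0 < g\<close>
        by (auto simp: R_def D_def norm_mult mult_right_mono simp flip: of_real_diff)
    qed
    then show "g * norm (Q x) \<le> norm (B *v x - a *\<^sub>R x)"
      unfolding MD using \<open>0 < g\<close> by (simp add: Q_def)
  qed
  then show ?thesis by blast
qed

end

lemma Herm_unitary_eigenbasis:
  assumes "B \<in> Herm"
  obtains P \<sigma> where "unitary_eigenbasis B P \<sigma>"
  using Herm_spectral[OF assms] unfolding unitary_eigenbasis_def by metis

text \<open>One half of the min-max principle: the eigenvectors of rank at most \<open>j\<close>
  span a suitable subspace.\<close>

lemma eigval_up_subspace: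
  fixes B :: "complex^'d^'d"
  assumes "B \<in> Herm" "j \<in> {1..CARD('d)}"
  obtains X where "subspace X" "dim X = 2 * j" "\<And>x. x \<in> X \<Longrightarrow> x \<bullet> (B *v x) \<le> eigval_up j B * (x \<bullet> x)"
proof -
  obtain P \<sigma> where "unitary_eigenbasis B P \<sigma>" using Herm_unitary_eigenbasis[OF assms(1)] .
  then interpret unitary_eigenbasis B P \<sigma> .
  show thesis
  proof (rule that[of "eigspan {1..j}"])
    show "dim (eigspan {1..j}) = 2 * j" using assms(2) by (simp add: dim_eigspan)
    show "x \<bullet> (B *v x) \<le> eigval_up j B * (x \<bullet> x)" if "x \<in> eigspan {1..j}" for x
      using that assms(2) by (rule_tac eigspan_le) (auto intro: mono)
  qed (rule subspace_eigspan)
qed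

text \<open>The other half: by a dimension count, \<open>X\<close> meets the span of the
  eigenvectors of rank at least \<open>j\<close>, where the form is at least
  \<open>eigval_up j B\<close>. Admitting real subspaces makes room for images under maps that are
  only known to be real linear.\<close>

lemma eigval_up_le:
  fixes B :: "complex^'d^'d"
  assumes "B \<in> Herm" "j \<in> {1..CARD('d)}"
    and X: "subspace X" "2 * j \<le> dim X" "\<And>x. x \<in> X \<Longrightarrow> x \<bullet> (B *v x) \<le> s * (x \<bullet> x)"
  shows "eigval_up j B \<le> s"
proof -
  obtain P \<sigma> where "unitary_eigenbasis B P \<sigma>" using Herm_unitary_eigenbasis[OF assms(1)] .
  then interpret unitary_eigenbasis B P \<sigma> .
  let ?Y = "eigspan {j..CARD('d)}"
  have "dim ?Y = 2 * (CARD('d) + 1 - j)" using assms(2) by (simp add: dim_eigspan)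
  then have "2 * CARD('d) + 2 \<le> dim X + dim ?Y" using X(2) assms(2) by auto
  also have "\<dots> = dim {x + y |x y. x \<in> X \<and> y \<in> ?Y} + dim (X \<inter> ?Y)"
    by (rule dim_sums_Int[symmetric, OF X(1) subspace_eigspan])
  also have "\<dots> \<le> 2 * CARD('d) + dim (X \<inter> ?Y)"
    using dim_subset_UNIV[of "{x + y |x y. x \<in> X \<and> y \<in> ?Y}"] by simp
  finally have "dim (X \<inter> ?Y) \<noteq> 0" by linarith
  then obtain x where x: "x \<in> X" "x \<in> ?Y" "x \<noteq> 0" by (auto simp: dim_eq_0)
  have "eigval_up j B * (x \<bullet> x) \<le> x \<bullet> (B *v x)"
    using x(2) assms(2) by (rule_tac eigspan_ge) (auto intro: mono)
  also have "\<dots> \<le> s * (x \<bullet> x)" by (rule X(3)[OF x(1)])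
  finally show ?thesis using x(3) by simp
qed

lemma inner_matrix_vector_le: "x \<bullet> (D *v y) \<le> norm (D :: complex^'d^'d) * norm x * norm y"
  using norm_cauchy_schwarz[of x "D *v y"] mult_left_mono[OF norm_matrix_vector_le[of D y] norm_ge_zero[of x]]
  by (simp add: mult_ac)

text \<open>Weyl's inequality: a test subspace for \<open>A\<close> is one for \<open>B\<close> once
  the level is raised by \<open>norm (B - A)\<close>; the absolute value follows by
  symmetry.\<close>

lemma eigval_up_lipschitz:
  fixes A B :: "complex^'d^'d"
  assumes "A \<in> Herm" "B \<in> Herm" "j \<in> {1..CARD('d)}"
  shows "\<bar>eigval_up j A - eigval_up j B\<bar> \<le> norm (A - B)"
proof -
  have "eigval_up j B \<le> eigval_up j A + norm (B - A)" if AB: "A \<in> Herm" "B \<in> Herm" for A B :: "complex^'d^'d"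
  proof -
    obtain X where X: "subspace X" "dim X = 2 * j" "\<And>x. x \<in> X \<Longrightarrow> x \<bullet> (A *v x) \<le> eigval_up j A * (x \<bullet> x)"
      using eigval_up_subspace[OF AB(1) assms(3)] by blast
    show ?thesis
    proof (rule eigval_up_le[OF AB(2) assms(3) X(1)])
      fix x assume "x \<in> X"
      have "B *v x = A *v x + (B - A) *v x" by (simp flip: matrix_vector_mult_add_rdistrib)
      then show "x \<bullet> (B *v x) \<le> (eigval_up j A + norm (B - A)) * (x \<bullet> x)"
        using X(3)[OF \<open>x \<in> X\<close>] inner_matrix_vector_le[of x "B - A" x]
        by (simp add: inner_add_right distrib_right dot_square_norm power2_eq_square)
    qed (use X(2) in auto)
  qed
  from this[OF assms(1,2)] this[OF assms(2,1)] show ?thesis by (simp add: norm_minus_commute abs_le_iff)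
qed

section \<open>Perturbation of eigenvalues with a gap\<close>

lemma abs_eigval_up_le:
  fixes B :: "complex^'d^'d"
  assumes "B \<in> Herm" "j \<in> {1..CARD('d)}"
  shows "\<bar>eigval_up j B\<bar> \<le> norm B"
proof -
  obtain P \<sigma> where "unitary_eigenbasis B P \<sigma>" using Herm_unitary_eigenbasis[OF assms(1)] .
  then interpret unitary_eigenbasis B P \<sigma> .
  have "dim (eigspan {j}) = 2" using assms(2) by (simp add: dim_eigspan)
  then have "\<not> eigspan {j} \<subseteq> {0}" by (metis dim_eq_0 zero_neq_numeral)
  then obtain x where x: "x \<in> eigspan {j}" "x \<noteq> 0" by blast
  have "x \<bullet> (B *v x) = eigval_up j B * (x \<bullet> x)"
    using eigspan_le[OF x(1), of "eigval_up j B"] eigspan_ge[OF x(1), of "eigval_up j B"] by force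
  moreover have "\<bar>x \<bullet> (B *v x)\<bar> \<le> norm x * (norm B * norm x)"
    using Cauchy_Schwarz_ineq2[of x "B *v x"] mult_left_mono[OF norm_matrix_vector_le[of B x] norm_ge_zero[of x]]
    by linarith
  ultimately have "\<bar>eigval_up j B\<bar> * (norm x)\<^sup>2 \<le> norm B * (norm x)\<^sup>2"
    by (simp add: abs_mult dot_square_norm power2_eq_square mult_ac)
  then show ?thesis using x(2) by simp
qed

text \<open>Coincidence with \<open>a\<close> is allowed with any multiplicity; only small nonzero
  distances are excluded.\<close>

definition eigval_gap :: "real \<Rightarrow> real \<Rightarrow> complex^'d^'d \<Rightarrow> bool" where
  "eigval_gap g a B \<longleftrightarrow> (\<forall>i\<in>{1..CARD('d)}. eigval_up i B = a \<or> g \<le> \<bar>eigval_up i B - a\<bar>)"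

text \<open>Think of \<open>A\<close>, \<open>A'\<close> as values of the limit at two points and of
  \<open>B\<close>, \<open>B'\<close> as those of a perturbation. The optimal subspace for
  \<open>B\<close>, carried over by \<open>S\<close>, tests \<open>B'\<close>. Since
  \<open>S\<close> does not increase the shifted form, \<delta> enters only multiplied by the size
  of the perturbations.\<close>

lemma eigval_up_second_difference_le:
  fixes A A' B B' :: "complex^'d^'d"
  assumes H: "A \<in> Herm" "A' \<in> Herm" "B \<in> Herm" "B' \<in> Herm" and j: "j \<in> {1..CARD('d)}"
    and "0 < g" and gap: "eigval_gap g (eigval_up j A) A" "eigval_gap g (eigval_up j A') A'"
    and N: "0 < N" "norm A' \<le> N"
    and K: "K = 2 / g + 8 * N / g\<^sup>2" and \<delta>: "\<delta> = 2 * norm (A - A')"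
    and small: "\<delta> \<le> g / 2" "8 * N * \<delta> \<le> g\<^sup>2" "K * \<delta> \<le> 1 / 2"
  shows "(eigval_up j B' - eigval_up j A') - (eigval_up j B - eigval_up j A)
    \<le> 4 * (norm ((B' - A') - (B - A)) + 3 * K * \<delta> * (norm (B' - A') + norm (B - A)))"
proof -
  define a a' t where "a = eigval_up j A" and "a' = eigval_up j A'" and "t = eigval_up j B - a"
  define D D' where "D = B - A" and "D' = B' - A'"
  define R where "R = norm (D' - D) + 3 * K * \<delta> * (norm D' + norm D)"
  define M M' where "M = (\<lambda>x. A *v x - a *\<^sub>R x)" and "M' = (\<lambda>x. A' *v x - a' *\<^sub>R x)"
  have "0 \<le> \<delta>" by (simp add: \<delta>)
  moreover have "0 < K" using \<open>0 < g\<close> N(1) unfolding K by (simp add: add_pos_pos)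
  ultimately have "0 \<le> R" by (simp add: R_def)
  obtain P \<sigma> where "unitary_eigenbasis A P \<sigma>" using Herm_unitary_eigenbasis[OF H(1)] .
  from unitary_eigenbasis.gapped_selfadjoint_eigval[OF this \<open>0 < g\<close>]
  obtain Q where Q: "gapped_selfadjoint M Q g"
    using gap(1) unfolding M_def a_def eigval_gap_def by blast
  obtain P' \<sigma>' where "unitary_eigenbasis A' P' \<sigma>'" using Herm_unitary_eigenbasis[OF H(2)] .
  from unitary_eigenbasis.gapped_selfadjoint_eigval[OF this \<open>0 < g\<close>]
  obtain Q' where Q': "gapped_selfadjoint M' Q' g"
    using gap(2) unfolding M'_def a'_def eigval_gap_def by blast
  \<comment> \<open>The factor 2 in \<delta> accounts for the matrices and for the shifts
    \<open>a\<close>, \<open>a'\<close>, whose difference is controlled by Weyl's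
    inequality.\<close>
  have "norm (M x - M' x) \<le> \<delta> * norm x" for x
  proof -
    have "M x - M' x = (A - A') *v x - (a - a') *\<^sub>R x"
      by (simp add: M_def M'_def matrix_vector_mult_diff_rdistrib algebra_simps)
    then have "norm (M x - M' x) \<le> norm (A - A') * norm x + \<bar>a - a'\<bar> * norm x"
      using norm_triangle_ineq4[of "(A - A') *v x" "(a - a') *\<^sub>R x"] norm_matrix_vector_le[of "A - A'" x] by simp
    also have "\<bar>a - a'\<bar> * norm x \<le> norm (A - A') * norm x"
      unfolding a_def a'_def by (rule mult_right_mono[OF eigval_up_lipschitz[OF H(1,2) j] norm_ge_zero])
    finally show ?thesis by (simp add: \<delta> mult_ac)
  qed
  \<comment> \<open>The shift is bounded by \<open>N\<close> as well, so the transfer applies with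
    \<open>2 * N\<close>, whence the \<open>8 * N\<close> in \<open>K\<close>.\<close>
  moreover have "norm (M' x) \<le> (2 * N) * norm x" for x
  proof -
    have "norm (M' x) \<le> norm A' * norm x + \<bar>a'\<bar> * norm x"
      unfolding M'_def using norm_triangle_ineq4[of "A' *v x" "a' *\<^sub>R x"] norm_matrix_vector_le[of A' x] by simp
    also have "\<dots> \<le> N * norm x + N * norm x"
      using N(2) abs_eigval_up_le[OF H(2) j] by (intro add_mono mult_right_mono) (auto simp: a'_def)
    finally show ?thesis by simp
  qed
  ultimately obtain S where S: "linear S" "\<And>x. norm (S x - x) \<le> K * \<delta> * norm x"
      "\<And>x. S x \<bullet> M' (S x) \<le> x \<bullet> M x"
    using gapped_selfadjoint_transfer[OF Q Q', of \<delta> "2 * N"] N(1) \<open>0 \<le> \<delta>\<close> small by (auto simp: K)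
  \<comment> \<open>\<open>K * \<delta> \<le> 1 / 2\<close> makes \<open>S\<close> injective, so
    that the dimension of \<open>X\<close> survives.\<close>
  have half: "norm x / 2 \<le> norm (S x)" "norm (S x) \<le> 2 * norm x" for x
    using S(2)[of x] mult_right_mono[OF small(3) norm_ge_zero[of x]]
      norm_triangle_ineq2[of x "x - S x"] norm_triangle_ineq2[of "S x" x]
    by (auto simp: norm_minus_commute)
  obtain X where X: "subspace X" "dim X = 2 * j" "\<And>x. x \<in> X \<Longrightarrow> x \<bullet> (B *v x) \<le> eigval_up j B * (x \<bullet> x)"
    using eigval_up_subspace[OF H(3) j] by blast
  have "eigval_up j B' \<le> a' + t + 4 * R"
  proof (rule eigval_up_le[OF H(4) j])
    show "subspace (S ` X)" by (rule linear_subspace_image[OF S(1) X(1)])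
    have "inj S" using half(1) by (metis S(1) linear_injective_0 norm_le_zero_iff divide_le_0_iff norm_zero not_numeral_le_zero)
    then have "dim (S ` X) = dim X" by (intro dim_image_eq S(1)) (auto intro: inj_on_subset)
    then show "2 * j \<le> dim (S ` X)" using X(2) by simp
  next
    fix w assume "w \<in> S ` X"
    then obtain x where x: "x \<in> X" and w: "w = S x" by blast
    define n where "n = norm x"
    have wx: "norm (w - x) \<le> K * \<delta> * n" "norm w \<le> 2 * n" "0 \<le> n"
      using S(2) half(2) by (auto simp: w n_def)
    have "w \<bullet> (B' *v w) = w \<bullet> M' w + a' * (w \<bullet> w) + w \<bullet> (D' *v w)"
      by (simp add: M'_def D'_def matrix_vector_mult_diff_rdistrib inner_diff_right)
    moreover have "x \<bullet> M x = x \<bullet> (B *v x) - a * (x \<bullet> x) - x \<bullet> (D *v x)"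
      by (simp add: M_def D_def matrix_vector_mult_diff_rdistrib inner_diff_right)
    moreover have "w \<bullet> M' w \<le> x \<bullet> M x" using S(3) w by simp
    moreover have "x \<bullet> (B *v x) \<le> (t + a) * (x \<bullet> x)" using X(3)[OF x] by (simp add: t_def)
    \<comment> \<open>The term with factor \<open>t\<close> arises because the level on
      \<open>X\<close> refers to \<open>x\<close>, that on its image to \<open>w\<close>.\<close>
    ultimately have "w \<bullet> (B' *v w) - (a' + t) * (w \<bullet> w)
        \<le> t * (x \<bullet> x - w \<bullet> w) + (w \<bullet> (D' *v w) - x \<bullet> (D *v x))"
      by (simp add: algebra_simps)
    also have "t * (x \<bullet> x - w \<bullet> w) \<le> norm D * (3 * (K * \<delta>) * n\<^sup>2)"
    proof -
      have "\<bar>x \<bullet> x - w \<bullet> w\<bar> = \<bar>(w - x) \<bullet> (w + x)\<bar>"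
        by (simp add: inner_diff_left inner_add_right inner_commute[of w x])
      also have "\<dots> \<le> norm (w - x) * norm (w + x)" by (rule Cauchy_Schwarz_ineq2)
      also have "\<dots> \<le> (K * \<delta> * n) * (3 * n)"
        using wx norm_triangle_ineq[of w x] \<open>0 \<le> \<delta>\<close> \<open>0 < K\<close>
        by (intro mult_mono mult_nonneg_nonneg) (auto simp: n_def)
      finally have 1: "\<bar>x \<bullet> x - w \<bullet> w\<bar> \<le> 3 * (K * \<delta>) * n\<^sup>2" by (simp add: power2_eq_square mult_ac)
      have "\<bar>t\<bar> \<le> norm D" unfolding t_def a_def D_def by (rule eigval_up_lipschitz[OF H(3,1) j])
      then have "\<bar>t\<bar> * \<bar>x \<bullet> x - w \<bullet> w\<bar> \<le> norm D * (3 * (K * \<delta>) * n\<^sup>2)"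
        using 1 by (intro mult_mono) auto
      then show ?thesis using abs_ge_self[of "t * (x \<bullet> x - w \<bullet> w)"] by (simp add: abs_mult)
    qed
    also have "w \<bullet> (D' *v w) - x \<bullet> (D *v x) \<le> norm D' * (3 * (K * \<delta>) * n\<^sup>2) + norm (D' - D) * n\<^sup>2"
    proof -
      \<comment> \<open>Pass from \<open>w\<close> to \<open>x\<close> one argument at a time, then
        from \<open>D'\<close> to \<open>D\<close>.\<close>
      have "w \<bullet> (D' *v w) - x \<bullet> (D *v x) = (w - x) \<bullet> (D' *v w) + x \<bullet> (D' *v (w - x)) + x \<bullet> ((D' - D) *v x)"
        by (simp add: matrix_vector_mult_diff_rdistrib matrix_vector_mult_diff_distrib inner_diff_right inner_diff_left)
      also have "\<dots> \<le> norm D' * (K * \<delta> * n) * (2 * n) + norm D' * n * (K * \<delta> * n) + norm (D' - D) * n * n"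
        using inner_matrix_vector_le[of "w - x" D' w] inner_matrix_vector_le[of x D' "w - x"]
          inner_matrix_vector_le[of x "D' - D" x] wx
          mult_mono[of "norm D' * norm (w - x)" "norm D' * (K * \<delta> * n)" "norm w" "2 * n"]
          mult_left_mono[of "norm (w - x)" "K * \<delta> * n" "norm D' * n"]
          mult_left_mono[of "norm (w - x)" "K * \<delta> * n" "norm D'"] \<open>0 \<le> \<delta>\<close> \<open>0 < K\<close>
        unfolding n_def by (smt (verit) mult_nonneg_nonneg norm_ge_zero)
      finally show ?thesis by (simp add: power2_eq_square algebra_simps)
    qed
    finally have "w \<bullet> (B' *v w) - (a' + t) * (w \<bullet> w) \<le> R * n\<^sup>2" by (simp add: R_def algebra_simps)
    \<comment> \<open>The error is measured by \<open>norm x\<close>, but the test inequality needs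
      \<open>norm w\<close>; this costs the factor 4.\<close>
    moreover have "R * n\<^sup>2 \<le> R * (4 * (w \<bullet> w))"
    proof -
      have "(n / 2)\<^sup>2 \<le> (norm w)\<^sup>2" using half(1)[of x] by (intro power_mono) (auto simp: w n_def)
      then show ?thesis using \<open>0 \<le> R\<close> by (intro mult_left_mono) (auto simp: power2_norm_eq_inner power_divide)
    qed
    ultimately show "w \<bullet> (B' *v w) \<le> (a' + t + 4 * R) * (w \<bullet> w)" by (simp add: algebra_simps)
  qed
  then show ?thesis by (simp add: R_def D_def D'_def t_def a_def a'_def)
qed

text \<open>\<open>C\<close> is chosen before the perturbation. Nearby points are covered by the
  second-difference estimate; for points more than \<rho> apart, Weyl's inequality bounds the left
  side by \<open>2 * \<epsilon>\<close>, hence by a multiple of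
  \<open>\<epsilon> * norm (x - y)\<close>.\<close>

lemma eigval_up_difference_lipschitz:
  fixes A :: "'a::real_normed_vector \<Rightarrow> complex^'d^'d"
  assumes j: "j \<in> {1..CARD('d)}" and "0 < g"
    and A: "A ` E \<subseteq> Herm" "\<And>x. x \<in> E \<Longrightarrow> norm (A x) \<le> N"
      "\<And>x y. x \<in> E \<Longrightarrow> y \<in> E \<Longrightarrow> norm (A x - A y) \<le> L * norm (x - y)"
    and gap: "\<And>x. x \<in> E \<Longrightarrow> eigval_gap g (eigval_up j (A x)) (A x)"
  shows "\<exists>C>0. \<forall>A' \<epsilon>. A' ` E \<subseteq> Herm \<longrightarrow> (\<forall>x\<in>E. norm (A' x - A x) \<le> \<epsilon>) \<longrightarrow>
      (\<forall>x\<in>E. \<forall>y\<in>E. norm ((A' x - A x) - (A' y - A y)) \<le> \<epsilon> * norm (x - y)) \<longrightarrow>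
      (\<forall>x\<in>E. \<forall>y\<in>E. \<bar>(eigval_up j (A' x) - eigval_up j (A x)) - (eigval_up j (A' y) - eigval_up j (A y))\<bar>
        \<le> C * \<epsilon> * norm (x - y))"
proof -
  \<comment> \<open>Strictly positive bounds whatever the signs of \<open>N\<close> and
    \<open>L\<close>.\<close>
  define N1 L1 where "N1 = \<bar>N\<bar> + 1" and "L1 = \<bar>L\<bar> + 1"
  have pos: "0 < N1" "0 < L1" by (auto simp: N1_def L1_def)
  have AN: "norm (A x) \<le> N1" if "x \<in> E" for x using A(2)[OF that] by (simp add: N1_def)
  have AL: "norm (A x - A y) \<le> L1 * norm (x - y)" if "x \<in> E" "y \<in> E" for x y
  proof -
    have "L * norm (x - y) \<le> L1 * norm (x - y)" by (rule mult_right_mono) (auto simp: L1_def)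
    with A(3)[OF that] show ?thesis by linarith
  qed
  define K where "K = 2 / g + 8 * N1 / g\<^sup>2"
  have "0 < K" using \<open>0 < g\<close> pos unfolding K_def by (simp add: add_pos_pos)
  \<comment> \<open>\<open>c\<close> adds the reciprocals of the three thresholds on \<delta>, so
    \<open>\<delta> * c \<le> 1\<close> implies all smallness conditions; \<rho> ensures this for
    points at distance up to \<rho>.\<close>
  define c where "c = 2 / g + 8 * N1 / g\<^sup>2 + 2 * K"
  have "0 < c" using \<open>0 < g\<close> pos \<open>0 < K\<close> unfolding c_def by (simp add: add_pos_pos)
  define \<rho> where "\<rho> = 1 / (2 * L1 * c)"
  have "0 < \<rho>" using pos \<open>0 < c\<close> by (simp add: \<rho>_def)
  \<comment> \<open>The first two terms serve nearby points, with \<open>48 = 4 * 3 * 2 * 2\<close>;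
    the last one serves distant points.\<close>
  define C where "C = 4 + 48 * K * L1 + 2 / \<rho>"
  show ?thesis
  proof (intro exI[of _ C] conjI allI impI ballI)
    show "0 < C" using \<open>0 < \<rho>\<close> \<open>0 < K\<close> pos by (simp add: C_def add_pos_pos)
    fix A' \<epsilon> x y
    assume A'_ball: "A' ` E \<subseteq> Herm" "\<forall>x\<in>E. norm (A' x - A x) \<le> \<epsilon>"
      "\<forall>x\<in>E. \<forall>y\<in>E. norm ((A' x - A x) - (A' y - A y)) \<le> \<epsilon> * norm (x - y)"
      and xy: "x \<in> E" "y \<in> E"
    note A' = A'_ball(1) bspec[OF A'_ball(2)] bspec[OF bspec[OF A'_ball(3)]]
    have "0 \<le> \<epsilon>" using A'(2)[OF xy(1)] norm_ge_zero order_trans by blast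
    let ?f = "\<lambda>x. eigval_up j (A' x) - eigval_up j (A x)"
    show "\<bar>?f x - ?f y\<bar> \<le> C * \<epsilon> * norm (x - y)"
    proof (cases "norm (x - y) \<le> \<rho>")
      case True
      have main: "?f y - ?f x \<le> (4 + 48 * K * L1) * \<epsilon> * norm (x - y)"
        if xy: "x \<in> E" "y \<in> E" and "norm (x - y) \<le> \<rho>" for x y
      proof -
        define \<delta> where "\<delta> = 2 * norm (A x - A y)"
        have "0 \<le> \<delta>" by (simp add: \<delta>_def)
        have \<delta>: "\<delta> \<le> 2 * L1 * norm (x - y)" using AL[OF xy] by (simp add: \<delta>_def)
        also have "\<dots> \<le> 2 * L1 * \<rho>" using that(3) pos by simp
        also have "\<dots> = 1 / c" using pos by (simp add: \<rho>_def)
        finally have "\<delta> * c \<le> 1" using \<open>0 < c\<close> by (simp add: field_simps)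
        moreover have "\<delta> * (2 / g) \<le> \<delta> * c" "\<delta> * (8 * N1 / g\<^sup>2) \<le> \<delta> * c" "\<delta> * (2 * K) \<le> \<delta> * c"
          using \<open>0 < g\<close> pos \<open>0 < K\<close> by (intro mult_left_mono[OF _ \<open>0 \<le> \<delta>\<close>]; simp add: c_def)+
        ultimately have "\<delta> * (2 / g) \<le> 1" "\<delta> * (8 * N1 / g\<^sup>2) \<le> 1" "\<delta> * (2 * K) \<le> 1" by linarith+
        then have small: "\<delta> \<le> g / 2" "8 * N1 * \<delta> \<le> g\<^sup>2" "K * \<delta> \<le> 1 / 2"
          using \<open>0 < g\<close> by (auto simp: field_simps)
        have "?f y - ?f x \<le> 4 * (norm ((A' y - A y) - (A' x - A x)) + 3 * K * \<delta> * (norm (A' y - A y) + norm (A' x - A x)))"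
          using A(1) A'(1) xy AN[OF xy(2)] pos gap \<open>0 < g\<close> small
          by (intro eigval_up_second_difference_le[OF _ _ _ _ j, where g = g and N = N1]) (auto simp: K_def \<delta>_def)
        also have "\<dots> \<le> 4 * (\<epsilon> * norm (x - y) + 3 * K * (2 * L1 * norm (x - y)) * (\<epsilon> + \<epsilon>))"
          using A'(3)[OF xy(2,1)] A'(2)[OF xy(1)] A'(2)[OF xy(2)] \<delta> \<open>0 < K\<close> pos \<open>0 \<le> \<delta>\<close> \<open>0 \<le> \<epsilon>\<close>
          by (intro mult_left_mono add_mono mult_mono) (auto simp: norm_minus_commute[of y x])
        also have "\<dots> = (4 + 48 * K * L1) * \<epsilon> * norm (x - y)" by (simp add: algebra_simps)
        finally show ?thesis .
      qed
      have "\<bar>?f x - ?f y\<bar> \<le> (4 + 48 * K * L1) * \<epsilon> * norm (x - y)"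
        using main[OF xy True] main[OF xy(2,1)] True by (simp add: norm_minus_commute[of y x] abs_le_iff)
      also have "\<dots> \<le> C * \<epsilon> * norm (x - y)"
        using \<open>0 \<le> \<epsilon>\<close> \<open>0 < \<rho>\<close> by (intro mult_right_mono) (auto simp: C_def)
      finally show ?thesis .
    next
      case False
      have W: "\<bar>?f z\<bar> \<le> \<epsilon>" if "z \<in> E" for z
        using eigval_up_lipschitz[of "A' z" "A z" j] A'(1) A(1) A'(2)[OF that] j that by force
      have "\<bar>?f x - ?f y\<bar> \<le> 2 * \<epsilon>" using W[OF xy(1)] W[OF xy(2)] by linarith
      also have "\<dots> = (2 / \<rho>) * \<epsilon> * \<rho>" using \<open>0 < \<rho>\<close> by simp
      also have "\<dots> \<le> C * \<epsilon> * norm (x - y)"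
        using False \<open>0 < \<rho>\<close> \<open>0 \<le> \<epsilon>\<close> \<open>0 < K\<close> pos by (intro mult_mono) (auto simp: C_def)
      finally show ?thesis .
    qed
  qed
qed

section \<open>Hausdorff measure\<close>

definition hausdorff_term :: "nat \<Rightarrow> 'a::metric_space set \<Rightarrow> ennreal" where
  "hausdorff_term m C = (if C = {} then 0 else ennreal (unit_ball_vol (real m) * (diameter C / 2) ^ m))"

definition fine_cover :: "real \<Rightarrow> 'a::metric_space set \<Rightarrow> (nat \<Rightarrow> 'a set) \<Rightarrow> bool" where
  "fine_cover \<delta> S C \<longleftrightarrow> S \<subseteq> (\<Union>i. C i) \<and> (\<forall>i. bounded (C i) \<and> diameter (C i) \<le> \<delta>)"

lemma hausdorff_premeasure_eq:
  "hausdorff_premeasure m \<delta> S = (INF C\<in>{C. fine_cover \<delta> S C}. \<Sum>i. hausdorff_term m (C i))"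
  by (simp add: hausdorff_premeasure_def hausdorff_term_def fine_cover_def)

lemma hausdorff_premeasure_le: "fine_cover \<delta> S C \<Longrightarrow> hausdorff_premeasure m \<delta> S \<le> (\<Sum>i. hausdorff_term m (C i))"
  unfolding hausdorff_premeasure_eq by (rule INF_lower) simp

lemma hausdorff_premeasure_approx:
  assumes "hausdorff_premeasure m \<delta> S < top" "0 < e"
  obtains C where "fine_cover \<delta> S C" "(\<Sum>i. hausdorff_term m (C i)) \<le> hausdorff_premeasure m \<delta> S + ennreal e"
proof -
  obtain C where "fine_cover \<delta> S C" "(\<Sum>i. hausdorff_term m (C i)) < hausdorff_premeasure m \<delta> S + ennreal e"
    using INF_approx_ennreal[OF assms(2) hausdorff_premeasure_eq[of m \<delta> S]] assms(1) by (auto simp: less_top)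
  then show thesis by (intro that) (auto simp: less_imp_le)
qed

lemma hausdorff_premeasure_le_measure: "0 < \<delta> \<Longrightarrow> hausdorff_premeasure m \<delta> S \<le> hausdorff_measure m S"
  unfolding hausdorff_measure_def by (rule SUP_upper) simp

lemma hausdorff_measure_mono: "S \<subseteq> T \<Longrightarrow> hausdorff_measure m S \<le> hausdorff_measure m T"
  unfolding hausdorff_measure_def hausdorff_premeasure_eq fine_cover_def
  by (intro SUP_mono' INF_superset_mono) auto

lemma sum_interleave:
  fixes f g :: "nat \<Rightarrow> 'a::comm_monoid_add"
  shows "(\<Sum>i<2 * n. if even i then f (i div 2) else g (i div 2)) = (\<Sum>i<n. f i) + (\<Sum>i<n. g i)"
  by (induction n) (simp_all add: ac_simps)

text \<open>Covers are sequences, so near-optimal covers of \<open>S\<close> and \<open>T\<close>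
  are merged by alternating between them.\<close>

lemma hausdorff_premeasure_Un:
  "hausdorff_premeasure m \<delta> (S \<union> T) \<le> hausdorff_premeasure m \<delta> S + hausdorff_premeasure m \<delta> T"
proof (rule ennreal_le_epsilon)
  fix e :: real assume "hausdorff_premeasure m \<delta> S + hausdorff_premeasure m \<delta> T < top" "0 < e"
  then have fin: "hausdorff_premeasure m \<delta> S < top" "hausdorff_premeasure m \<delta> T < top" "0 < e / 2" by auto
  obtain C where C: "fine_cover \<delta> S C" "(\<Sum>i. hausdorff_term m (C i)) \<le> hausdorff_premeasure m \<delta> S + ennreal (e / 2)"
    using hausdorff_premeasure_approx[OF fin(1,3)] .
  obtain D where D: "fine_cover \<delta> T D" "(\<Sum>i. hausdorff_term m (D i)) \<le> hausdorff_premeasure m \<delta> T + ennreal (e / 2)"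
    using hausdorff_premeasure_approx[OF fin(2,3)] .
  define E where "E i = (if even i then C (i div 2) else D (i div 2))" for i
  have "C i = E (2 * i)" "D i = E (2 * i + 1)" for i by (simp_all add: E_def)
  then have "(\<Union>i. C i) \<union> (\<Union>i. D i) \<subseteq> (\<Union>i. E i)" by blast
  moreover have "bounded (E i) \<and> diameter (E i) \<le> \<delta>" for i
    using C(1) D(1) by (simp add: E_def fine_cover_def)
  ultimately have "fine_cover \<delta> (S \<union> T) E" using C(1) D(1) unfolding fine_cover_def by blast
  then have "hausdorff_premeasure m \<delta> (S \<union> T) \<le> (\<Sum>i. hausdorff_term m (E i))" by (rule hausdorff_premeasure_le)
  also have "\<dots> \<le> (\<Sum>i. hausdorff_term m (C i)) + (\<Sum>i. hausdorff_term m (D i))"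
  proof (rule suminf_le_const)
    fix n
    have "(\<Sum>i<n. hausdorff_term m (E i)) \<le> (\<Sum>i<2 * n. hausdorff_term m (E i))" by (rule sum_mono2) auto
    also have "\<dots> = (\<Sum>i<n. hausdorff_term m (C i)) + (\<Sum>i<n. hausdorff_term m (D i))"
      by (subst sum_interleave[symmetric], rule sum.cong) (auto simp: E_def)
    also have "\<dots> \<le> (\<Sum>i. hausdorff_term m (C i)) + (\<Sum>i. hausdorff_term m (D i))"
      by (intro add_mono sum_le_suminf) auto
    finally show "(\<Sum>i<n. hausdorff_term m (E i)) \<le> (\<Sum>i. hausdorff_term m (C i)) + (\<Sum>i. hausdorff_term m (D i))" .
  qed simp
  also have "\<dots> \<le> (hausdorff_premeasure m \<delta> S + ennreal (e / 2)) + (hausdorff_premeasure m \<delta> T + ennreal (e / 2))"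
    by (rule add_mono[OF C(2) D(2)])
  also have "\<dots> = hausdorff_premeasure m \<delta> S + hausdorff_premeasure m \<delta> T + (ennreal (e / 2) + ennreal (e / 2))"
    by (simp only: ac_simps)
  also have "ennreal (e / 2) + ennreal (e / 2) = ennreal e" using \<open>0 < e\<close> by (simp flip: ennreal_plus)
  finally show "hausdorff_premeasure m \<delta> (S \<union> T) \<le> hausdorff_premeasure m \<delta> S + hausdorff_premeasure m \<delta> T + ennreal e" .
qed

lemma hausdorff_measure_Un: "hausdorff_measure m (S \<union> T) \<le> hausdorff_measure m S + hausdorff_measure m T"
proof -
  have "hausdorff_premeasure m \<delta> (S \<union> T) \<le> hausdorff_measure m S + hausdorff_measure m T" if "0 < \<delta>" for \<delta>
    using hausdorff_premeasure_Un add_mono[OF hausdorff_premeasure_le_measure[OF that] hausdorff_premeasure_le_measure[OF that]]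
    by (rule order_trans)
  then show ?thesis unfolding hausdorff_measure_def[of m "S \<union> T"] by (intro SUP_least) auto
qed

lemma hausdorff_measure_empty [simp]: "hausdorff_measure m {} = 0"
proof -
  have "hausdorff_premeasure m \<delta> ({} :: 'a set) \<le> 0" if "0 < \<delta>" for \<delta>
  proof -
    have "fine_cover \<delta> ({} :: 'a set) (\<lambda>_. {})" using that by (simp add: fine_cover_def diameter_def)
    from hausdorff_premeasure_le[OF this, of m] show ?thesis by (simp add: hausdorff_term_def)
  qed
  then show ?thesis unfolding hausdorff_measure_def by (auto intro!: antisym SUP_least)
qed

lemma hausdorff_measure_UN_le:
  "finite J \<Longrightarrow> hausdorff_measure m (\<Union>j\<in>J. S j) \<le> (\<Sum>j\<in>J. hausdorff_measure m (S j))"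
proof (induction rule: finite_induct)
  case (insert j J)
  then show ?case
    using hausdorff_measure_Un[of m "S j" "\<Union>j\<in>J. S j"] by (auto intro: order_trans add_left_mono)
qed simp

text \<open>Covers of the \<psi>-image are carried to the \<phi>-image, multiplying diameters by at
  most \<open>K\<close>. Parametrising both sets by \<open>I\<close> avoids naming the map between
  them and lets pairs of a point and a sheet serve as indices.\<close>

lemma hausdorff_measure_expanding:
  fixes \<phi> :: "'i \<Rightarrow> 'a::metric_space" and \<psi> :: "'i \<Rightarrow> 'b::metric_space"
  assumes "0 < K" and le: "\<And>i j. i \<in> I \<Longrightarrow> j \<in> I \<Longrightarrow> dist (\<phi> i) (\<phi> j) \<le> K * dist (\<psi> i) (\<psi> j)"
  shows "hausdorff_measure m (\<phi> ` I) \<le> ennreal (K ^ m) * hausdorff_measure m (\<psi> ` I)"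
proof -
  have "hausdorff_premeasure m \<delta> (\<phi> ` I) \<le> ennreal (K ^ m) * hausdorff_measure m (\<psi> ` I)" if "0 < \<delta>" for \<delta>
  proof -
    \<comment> \<open>The factor is moved to the left-hand side, leaving a bare sum on the right
      over which the infimum can be taken.\<close>
    have c: "ennreal (1 / K ^ m) * ennreal (K ^ m) = 1" using \<open>0 < K\<close> by (simp flip: ennreal_mult)
    have "ennreal (1 / K ^ m) * hausdorff_premeasure m \<delta> (\<phi> ` I) \<le> (\<Sum>i. hausdorff_term m (C i))"
      if C: "fine_cover (\<delta> / K) (\<psi> ` I) C" for C
    proof -
      define D where "D n = \<phi> ` {i \<in> I. \<psi> i \<in> C n}" for n
      have bdC: "bounded (C n)" and diamC: "diameter (C n) \<le> \<delta> / K" for n using C by (auto simp: fine_cover_def)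
      have dist_le: "dist u v \<le> K * diameter (C n)" if "u \<in> D n" "v \<in> D n" for u v n
      proof -
        obtain i j where ij: "i \<in> I" "j \<in> I" "\<psi> i \<in> C n" "\<psi> j \<in> C n" "u = \<phi> i" "v = \<phi> j"
          using \<open>u \<in> D n\<close> \<open>v \<in> D n\<close> by (auto simp: D_def)
        have "dist u v \<le> K * dist (\<psi> i) (\<psi> j)" using le ij by simp
        also have "\<dots> \<le> K * diameter (C n)"
          using diameter_bounded_bound[OF bdC ij(3,4)] \<open>0 < K\<close> by simp
        finally show ?thesis .
      qed
      have bdD: "bounded (D n)" for n
      proof (cases "D n = {}")
        case False
        then obtain u where "u \<in> D n" by blast
        then show ?thesis unfolding bounded_def using dist_le by blast
      qed simp
      have diamD: "diameter (D n) \<le> K * diameter (C n)" for n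
      proof (cases "D n = {}")
        case True
        then show ?thesis using diameter_ge_0[OF bdC[of n]] \<open>0 < K\<close> by (simp add: diameter_def)
      next
        case False
        then show ?thesis unfolding diameter_def[of "D n"] by (auto intro!: cSUP_least dist_le)
      qed
      have "fine_cover \<delta> (\<phi> ` I) D"
        unfolding fine_cover_def
      proof (intro conjI allI)
        show "\<phi> ` I \<subseteq> (\<Union>i. D i)" using C by (fastforce simp: fine_cover_def D_def)
        show "diameter (D n) \<le> \<delta>" for n
        proof -
          have "K * diameter (C n) \<le> K * (\<delta> / K)" using diamC[of n] \<open>0 < K\<close> by (intro mult_left_mono) auto
          then show ?thesis using diamD[of n] \<open>0 < K\<close> by simp
        qed
      qed (rule bdD)
      then have "hausdorff_premeasure m \<delta> (\<phi> ` I) \<le> (\<Sum>n. hausdorff_term m (D n))"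
        by (rule hausdorff_premeasure_le)
      also have "\<dots> \<le> (\<Sum>n. ennreal (K ^ m) * hausdorff_term m (C n))"
      proof (rule suminf_le)
        fix n
        show "hausdorff_term m (D n) \<le> ennreal (K ^ m) * hausdorff_term m (C n)"
        proof (cases "D n = {}")
          case False
          then have "C n \<noteq> {}" by (auto simp: D_def)
          have "(diameter (D n) / 2) ^ m \<le> (K * (diameter (C n) / 2)) ^ m"
            using diamD[of n] diameter_ge_0[OF bdD[of n]] by (intro power_mono) auto
          then have "unit_ball_vol (real m) * (diameter (D n) / 2) ^ m
              \<le> unit_ball_vol (real m) * (K * (diameter (C n) / 2)) ^ m"
            by (rule mult_left_mono) simp
          also have "\<dots> = K ^ m * (unit_ball_vol (real m) * (diameter (C n) / 2) ^ m)"
            by (simp only: power_mult_distrib mult_ac)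
          finally have "unit_ball_vol (real m) * (diameter (D n) / 2) ^ m
              \<le> K ^ m * (unit_ball_vol (real m) * (diameter (C n) / 2) ^ m)" .
          then show ?thesis using False \<open>C n \<noteq> {}\<close> \<open>0 < K\<close>
            by (simp add: hausdorff_term_def diameter_ge_0 bdC ennreal_leI flip: ennreal_mult)
        qed (simp add: hausdorff_term_def)
      qed auto
      finally have "hausdorff_premeasure m \<delta> (\<phi> ` I) \<le> ennreal (K ^ m) * (\<Sum>n. hausdorff_term m (C n))"
        by (simp add: ennreal_suminf_cmult)
      then have "ennreal (1 / K ^ m) * hausdorff_premeasure m \<delta> (\<phi> ` I)
          \<le> ennreal (1 / K ^ m) * (ennreal (K ^ m) * (\<Sum>n. hausdorff_term m (C n)))"
        by (rule mult_left_mono) simp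
      then show ?thesis by (simp only: mult.assoc[symmetric] c mult_1_left)
    qed
    then have "ennreal (1 / K ^ m) * hausdorff_premeasure m \<delta> (\<phi> ` I) \<le> hausdorff_premeasure m (\<delta> / K) (\<psi> ` I)"
      unfolding hausdorff_premeasure_eq[of m "\<delta> / K"] by (intro INF_greatest) simp
    also have "\<dots> \<le> hausdorff_measure m (\<psi> ` I)"
      using \<open>0 < K\<close> \<open>0 < \<delta>\<close> by (intro hausdorff_premeasure_le_measure) simp
    finally have "ennreal (K ^ m) * (ennreal (1 / K ^ m) * hausdorff_premeasure m \<delta> (\<phi> ` I))
        \<le> ennreal (K ^ m) * hausdorff_measure m (\<psi> ` I)"
      by (rule mult_left_mono) simp
    then show ?thesis by (simp only: mult.assoc[symmetric] mult.commute[of "ennreal (K ^ m)"] c mult_1_left)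
  qed
  then show ?thesis unfolding hausdorff_measure_def[of m "\<phi> ` I"] by (intro SUP_least) auto
qed

text \<open>
  Covering by small cubes gives a constant that is far from optimal, but suffices to bound
  exceptional sets; the sharp constant \<open>1\<close> would need the isodiametric inequality.
\<close>

lemma hausdorff_measure_le_lborel:
  fixes S :: "(real^'m) set"
  assumes "open S" "bounded S"
  shows "hausdorff_measure CARD('m) S
    \<le> ennreal (unit_ball_vol (real CARD('m)) * real CARD('m) ^ CARD('m)) * emeasure lborel S"
proof -
  let ?m = "CARD('m)"
  let ?c = "unit_ball_vol (real ?m) * real ?m ^ ?m"
  \<comment> \<open>A bounding box with equal sides: its dyadic subdivision yields cubes, whose
    diameter and volume are comparable.\<close>
  obtain r where r: "0 < r" "S \<subseteq> cbox (- (\<Sum>i\<in>Basis. r *\<^sub>R i)) (\<Sum>i\<in>Basis. r *\<^sub>R i)"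
  proof -
    obtain b where b: "0 < b" "\<And>x. x \<in> S \<Longrightarrow> norm x \<le> b" using assms(2) by (auto simp: bounded_pos)
    have "S \<subseteq> cbox (- (\<Sum>i\<in>Basis. b *\<^sub>R i)) (\<Sum>i\<in>Basis. b *\<^sub>R i)"
    proof
      fix x assume "x \<in> S"
      then have "\<bar>x \<bullet> i\<bar> \<le> b" if "i \<in> Basis" for i using b(2) Basis_le_norm[OF that, of x] by fastforce
      then show "x \<in> cbox (- (\<Sum>i\<in>Basis. b *\<^sub>R i)) (\<Sum>i\<in>Basis. b *\<^sub>R i)"
        by (force simp: mem_box abs_le_iff)
    qed
    with b(1) show thesis by (rule that)
  qed
  let ?u = "- (\<Sum>i\<in>Basis. r *\<^sub>R i) :: real^'m" and ?v = "(\<Sum>i\<in>Basis. r *\<^sub>R i) :: real^'m"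
  have "hausdorff_premeasure ?m \<delta> S \<le> ennreal ?c * emeasure lborel S" if "0 < \<delta>" for \<delta>
  proof -
    \<comment> \<open>This gauge forces a cube chosen around a point of \<open>S\<close> to stay in
      \<open>S\<close> and to have diameter at most \<delta>; off \<open>S\<close> any open ball
      will do.\<close>
    define g where "g x = (if x \<in> S then ball x (\<delta> / 2) \<inter> S else ball x 1)" for x
    have "gauge g" using assms(1) \<open>0 < \<delta>\<close> by (auto simp: gauge_def g_def)
    have ne: "box ?u ?v \<noteq> {}" using r(1) by (auto simp: box_ne_empty)
    obtain \<D> where D: "countable \<D>" "\<Union>\<D> \<subseteq> cbox ?u ?v"
        "\<And>K. K \<in> \<D> \<Longrightarrow> interior K \<noteq> {} \<and> (\<exists>c d. K = cbox c d)"
        "pairwise (\<lambda>A B. interior A \<inter> interior B = {}) \<D>"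
        "\<And>K. K \<in> \<D> \<Longrightarrow> \<exists>x \<in> S \<inter> K. K \<subseteq> g x"
        "\<And>u v. cbox u v \<in> \<D> \<Longrightarrow> \<exists>n. \<forall>i \<in> Basis. v \<bullet> i - u \<bullet> i = (?v \<bullet> i - ?u \<bullet> i) / 2^n"
        "S \<subseteq> \<Union>\<D>"
      by (rule covering_lemma[OF r(2) ne \<open>gauge g\<close>]) (rule that)
    have KS: "K \<subseteq> S" "diameter K \<le> \<delta>" "bounded K"
        "hausdorff_term ?m K \<le> ennreal ?c * emeasure lborel (interior K)" if K: "K \<in> \<D>" for K
    proof -
      obtain x where x: "x \<in> S" "K \<subseteq> g x" using D(5)[OF K] by blast
      then have sub: "K \<subseteq> ball x (\<delta> / 2)" "K \<subseteq> S" by (auto simp: g_def)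
      then show "K \<subseteq> S" "bounded K" using bounded_subset bounded_ball by blast+
      have "diameter K \<le> diameter (ball x (\<delta> / 2))" by (rule diameter_subset[OF sub(1)]) simp
      also have "\<dots> \<le> \<delta>" using \<open>0 < \<delta>\<close> by simp
      finally show "diameter K \<le> \<delta>" .
      obtain u v where uv: "K = cbox u v" "interior K \<noteq> {}" using D(3)[OF K] by blast
      then obtain n where n: "\<And>i. i \<in> Basis \<Longrightarrow> v \<bullet> i - u \<bullet> i = (?v \<bullet> i - ?u \<bullet> i) / 2^n"
        using D(6) K by blast
      define s where "s = 2 * r / 2 ^ n"
      have s: "v \<bullet> i - u \<bullet> i = s" if "i \<in> Basis" for i using n[OF that] that by (simp add: s_def)
      have "0 < s" using r(1) by (simp add: s_def)
      have le: "u \<bullet> i \<le> v \<bullet> i" if "i \<in> Basis" for i using s[OF that] \<open>0 < s\<close> by simp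
      have "diameter K = norm (v - u)" using le by (simp add: uv(1) diameter_cbox dist_norm norm_minus_commute)
      \<comment> \<open>Bounding the diagonal by the sum of the sides is the source of the factor
        \<open>real ?m ^ ?m\<close>.\<close>
      also have "\<dots> \<le> (\<Sum>i\<in>Basis. \<bar>(v - u) \<bullet> i\<bar>)" by (rule norm_le_l1)
      also have "\<dots> = real ?m * s" using \<open>0 < s\<close> by (simp add: inner_diff_left s)
      finally have "diameter K / 2 \<le> real ?m * s" using diameter_ge_0[OF \<open>bounded K\<close>] by simp
      then have "(diameter K / 2) ^ ?m \<le> (real ?m * s) ^ ?m"
        using diameter_ge_0[OF \<open>bounded K\<close>] by (intro power_mono) auto
      then have "unit_ball_vol (real ?m) * (diameter K / 2) ^ ?m \<le> unit_ball_vol (real ?m) * (real ?m * s) ^ ?m"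
        by (rule mult_left_mono) simp
      also have "\<dots> = ?c * s ^ ?m" by (simp add: power_mult_distrib)
      finally have "hausdorff_term ?m K \<le> ennreal (?c * s ^ ?m)"
        by (simp add: hausdorff_term_def ennreal_leI)
      also have "\<dots> = ennreal ?c * ennreal (s ^ ?m)" using \<open>0 < s\<close> by (subst ennreal_mult) auto
      \<comment> \<open>The open cube has the same volume, and it is the interiors that are pairwise
        disjoint.\<close>
      also have "ennreal (s ^ ?m) = emeasure lborel (interior K)"
        using le by (simp add: uv(1) emeasure_lborel_box inner_diff_left s)
      finally show "hausdorff_term ?m K \<le> ennreal ?c * emeasure lborel (interior K)" .
    qed
    \<comment> \<open>The family of cubes is countable, possibly finite; indices outside the
      enumeration get the empty set, which contributes 0.\<close>
    define C where "C i = (if i \<in> to_nat_on \<D> ` \<D> then from_nat_into \<D> i else {})" for i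
    have C: "C i \<in> \<D> \<or> C i = {}" for i using D(1) by (auto simp: C_def)
    have C_inj: "interior (C i) \<inter> interior (C j) = {}" if "i \<noteq> j" for i j
    proof (cases "i \<in> to_nat_on \<D> ` \<D> \<and> j \<in> to_nat_on \<D> ` \<D>")
      case True
      then have "C i \<in> \<D>" "C j \<in> \<D>" "C i \<noteq> C j" using D(1) that by (auto simp: C_def)
      then show ?thesis using D(4) by (auto simp: pairwise_def)
    qed (auto simp: C_def)
    have "fine_cover \<delta> S C"
      unfolding fine_cover_def
    proof (intro conjI allI)
      show "S \<subseteq> (\<Union>i. C i)"
      proof
        fix x assume "x \<in> S"
        then obtain K where K: "K \<in> \<D>" "x \<in> K" using D(7) by blast
        then have "C (to_nat_on \<D> K) = K" using D(1) by (simp add: C_def)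
        with K(2) show "x \<in> (\<Union>i. C i)" by blast
      qed
      show "bounded (C i)" "diameter (C i) \<le> \<delta>" for i
        using C[of i] KS(2,3) \<open>0 < \<delta>\<close> by auto
    qed
    then have "hausdorff_premeasure ?m \<delta> S \<le> (\<Sum>i. hausdorff_term ?m (C i))" by (rule hausdorff_premeasure_le)
    also have "\<dots> \<le> (\<Sum>i. ennreal ?c * emeasure lborel (interior (C i)))"
    proof (rule suminf_le)
      show "hausdorff_term ?m (C i) \<le> ennreal ?c * emeasure lborel (interior (C i))" for i
        using C[of i] KS(4) by (cases "C i = {}") (simp add: hausdorff_term_def, blast)
    qed auto
    also have "\<dots> = ennreal ?c * emeasure lborel (\<Union>i. interior (C i))"
      unfolding ennreal_suminf_cmult
      by (subst suminf_emeasure) (use C_inj in \<open>auto simp: disjoint_family_on_def\<close>)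
    also have "\<dots> \<le> ennreal ?c * emeasure lborel S"
    proof (intro mult_left_mono emeasure_mono)
      have "interior (C i) \<subseteq> S" for i
        using C[of i] KS(1)[of "C i"] interior_subset[of "C i"] by auto
      then show "(\<Union>i. interior (C i)) \<subseteq> S" by (rule UN_least)
    qed (use assms(1) in auto)
    finally show ?thesis .
  qed
  then show ?thesis unfolding hausdorff_measure_def by (intro SUP_least) auto
qed

section \<open>Distances between points of graphs, and passage to the limit\<close>

lemma dist_fst_le_dist_Pair: "dist x y \<le> dist (x, s) (y, t)"
  and dist_snd_le_dist_Pair: "dist s t \<le> dist (x, s) (y, t)"
  by (simp_all add: dist_Pair_Pair)

lemma dist_Pair_real_perturb:
  fixes s t s' t' :: real
  shows "dist (x, s) (y, t) \<le> dist (x, s') (y, t') + \<bar>(s - t) - (s' - t')\<bar>"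
proof -
  have "dist (x, s) (y, t) \<le> dist (x, s) (y, s - (s' - t')) + dist (y, s - (s' - t')) (y, t)"
    by (rule dist_triangle)
  then show ?thesis by (simp add: dist_Pair_Pair dist_real_def)
qed

text \<open>The perturbation is controlled by the left-hand distance itself and absorbed there;
  \<open>c \<le> 1 / 4\<close> gives \<open>1 / (1 - 2 * c) \<le> 1 + 4 * c\<close>. The bound may
  thus use vertical as well as horizontal distance, which helps for points on different
  graphs.\<close>

lemma dist_Pair_real_perturb_le:
  fixes s t s' t' :: real
  assumes "\<bar>(s - t) - (s' - t')\<bar> \<le> c * (dist x y + \<bar>s - t\<bar>)" "0 \<le> c" "c \<le> 1 / 4"
  shows "dist (x, s) (y, t) \<le> (1 + 4 * c) * dist (x, s') (y, t')"
proof -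
  let ?d = "dist (x, s) (y, t)" and ?d' = "dist (x, s') (y, t')"
  have "c * (dist x y + \<bar>s - t\<bar>) \<le> c * (?d + ?d)"
    using dist_fst_le_dist_Pair[of x y s t] dist_snd_le_dist_Pair[of s t x y] assms(2)
    by (intro mult_left_mono) (auto simp: dist_real_def)
  then have d: "(1 - 2 * c) * ?d \<le> ?d'"
    using dist_Pair_real_perturb[of x s y t s' t'] assms(1) by (simp add: algebra_simps)
  have "1 \<le> (1 + 4 * c) * (1 - 2 * c)"
    using mult_left_mono[OF assms(3), of "8 * c"] assms(2) by (simp add: algebra_simps)
  then have "?d \<le> ((1 + 4 * c) * (1 - 2 * c)) * ?d" using mult_right_mono by fastforce
  also have "\<dots> = (1 + 4 * c) * ((1 - 2 * c) * ?d)" by (simp only: mult.assoc)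
  also have "\<dots> \<le> (1 + 4 * c) * ?d'" using d assms(2) by (intro mult_left_mono) auto
  finally show ?thesis .
qed

text \<open>Along \<open>K = 1 + 1 / (k + 1)\<close> and \<open>p = k\<close> both losses vanish,
  and for each fixed pair only large \<open>n\<close> matter. An infinite lower limit is split off
  because the limit of the products is taken at a finite value.\<close>

lemma ennreal_le_liminf_of_approx:
  fixes a :: ennreal and b r :: "nat \<Rightarrow> ennreal"
  assumes "\<And>p K. 1 < K \<Longrightarrow> eventually (\<lambda>n. a \<le> ennreal K * b n + r p) sequentially"
    and r: "r \<longlonglongrightarrow> 0"
  shows "a \<le> liminf b"
proof (cases "liminf b = top")
  case False
  define l where "l = liminf b"
  have "l < top" using False by (simp add: l_def less_top)
  have lim0: "(\<lambda>k. 1 / real (Suc k)) \<longlonglongrightarrow> 0" by (rule LIMSEQ_Suc[OF lim_1_over_n])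
  have "a \<le> ennreal (1 + 1 / real (Suc k)) * (l + ennreal (1 / real (Suc k))) + r k" for k
  proof -
    have less: "l < l + ennreal (1 / real (Suc k))"
      using \<open>l < top\<close> ennreal_add_left_cancel_less[of l 0 "ennreal (1 / real (Suc k))"] by (simp add: less_top)
    \<comment> \<open>Values of \<open>b\<close> close to its lower limit recur, so some such
      \<open>n\<close> also satisfies the eventual bound.\<close>
    have "frequently (\<lambda>n. b n < l + ennreal (1 / real (Suc k))) sequentially"
      unfolding frequently_def
    proof
      assume "eventually (\<lambda>n. \<not> b n < l + ennreal (1 / real (Suc k))) sequentially"
      then have "l + ennreal (1 / real (Suc k)) \<le> l"
        unfolding l_def not_less by (rule Liminf_bounded)
      with less show False by simp
    qed
    moreover have "eventually (\<lambda>n. a \<le> ennreal (1 + 1 / real (Suc k)) * b n + r k) sequentially"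
      by (rule assms(1)) simp
    ultimately have "frequently (\<lambda>n. b n < l + ennreal (1 / real (Suc k)) \<and> a \<le> ennreal (1 + 1 / real (Suc k)) * b n + r k) sequentially"
      by (rule frequently_eventually_frequently)
    then obtain n where "b n < l + ennreal (1 / real (Suc k))" "a \<le> ennreal (1 + 1 / real (Suc k)) * b n + r k"
      by (metis (mono_tags, lifting) frequently_ex)
    then show ?thesis by (meson add_right_mono less_imp_le mult_left_mono order_trans zero_le)
  qed
  moreover have "(\<lambda>k. ennreal (1 + 1 / real (Suc k)) * (l + ennreal (1 / real (Suc k))) + r k) \<longlonglongrightarrow> ennreal (1 + 0) * (l + ennreal 0) + 0"
    using \<open>l < top\<close> by (intro tendsto_add tendsto_mult_ennreal tendsto_ennrealI tendsto_const r lim0) auto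
  ultimately have "a \<le> ennreal (1 + 0) * (l + ennreal 0) + 0"
    by (intro LIMSEQ_le_const) auto
  then show ?thesis by (simp add: l_def)
qed simp

lemma ennreal_limsup_le_of_approx:
  fixes a :: ennreal and b r :: "nat \<Rightarrow> ennreal"
  assumes "\<And>p K. 1 < K \<Longrightarrow> eventually (\<lambda>n. b n \<le> ennreal K * a + r p) sequentially"
    and r: "r \<longlonglongrightarrow> 0"
  shows "limsup b \<le> a"
proof (cases "a = top")
  case False
  have lim0: "(\<lambda>k. 1 / real (Suc k)) \<longlonglongrightarrow> 0" by (rule LIMSEQ_Suc[OF lim_1_over_n])
  have "limsup b \<le> ennreal (1 + 1 / real (Suc k)) * a + r k" for k
    by (rule Limsup_bounded[OF assms(1)]) simp
  moreover have "(\<lambda>k. ennreal (1 + 1 / real (Suc k)) * a + r k) \<longlonglongrightarrow> ennreal (1 + 0) * a + 0"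
    using False by (intro tendsto_add tendsto_mult_ennreal tendsto_ennrealI tendsto_const r lim0) auto
  ultimately have "limsup b \<le> ennreal (1 + 0) * a + 0"
    by (intro LIMSEQ_le_const) auto
  then show ?thesis by simp
qed simp

lemma ex_small_power_le:
  fixes C K :: real
  assumes "1 < K" "0 < C"
  obtains e where "0 < e" "C * e \<le> 1 / 4" "(1 + 4 * (C * e)) ^ m \<le> K"
proof -
  have "((\<lambda>e. (1 + 4 * (C * e)) ^ m) \<longlongrightarrow> (1 + 4 * (C * 0)) ^ m) (at_right 0)"
    by (intro tendsto_intros)
  then have "eventually (\<lambda>e. (1 + 4 * (C * e)) ^ m < K) (at_right 0)"
    by (rule order_tendstoD) (use assms in simp)
  moreover have "eventually (\<lambda>e. e < 1 / (4 * C)) (at_right (0::real))"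
    using assms by (intro eventually_at_right_less order_tendstoD[OF tendsto_ident_at]) simp
  moreover have "eventually (\<lambda>e. 0 < e) (at_right (0::real))" by (rule eventually_at_right_less)
  ultimately have "eventually (\<lambda>e. 0 < e \<and> C * e \<le> 1 / 4 \<and> (1 + 4 * (C * e)) ^ m \<le> K) (at_right 0)"
    by eventually_elim (use assms in \<open>auto simp: field_simps\<close>)
  then obtain e where "0 < e \<and> C * e \<le> 1 / 4 \<and> (1 + 4 * (C * e)) ^ m \<le> K"
    using eventually_happens trivial_limit_at_right_real by blast
  then show thesis by (intro that) auto
qed

text \<open>The graph map has Lipschitz constant \<open>1 + L\<close> on \<open>S\<close>, so the
  crude comparison with Lebesgue measure carries over; it serves for exceptional sets.\<close>

lemma hausdorff_measure_graph_le:
  fixes S :: "(real^'m) set"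
  assumes "open S" "bounded S" "0 \<le> L" "\<And>x y. x \<in> S \<Longrightarrow> y \<in> S \<Longrightarrow> \<bar>f x - f y\<bar> \<le> L * dist x y"
  shows "hausdorff_measure CARD('m) (graph_map f ` S)
    \<le> ennreal ((1 + L) ^ CARD('m)) * (ennreal (unit_ball_vol (real CARD('m)) * real CARD('m) ^ CARD('m)) * emeasure lborel S)"
proof -
  have "hausdorff_measure CARD('m) (graph_map f ` S) \<le> ennreal ((1 + L) ^ CARD('m)) * hausdorff_measure CARD('m) ((\<lambda>x. x) ` S)"
  proof (rule hausdorff_measure_expanding)
    fix x y assume "x \<in> S" "y \<in> S"
    then show "dist (graph_map f x) (graph_map f y) \<le> (1 + L) * dist x y"
      using dist_Pair_real_perturb[of x "f x" y "f y" 0 0] assms(4)[of x y]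
      by (simp add: graph_map_def dist_Pair_Pair[of x 0 y 0] distrib_right)
  qed (use assms(3) in simp)
  also have "\<dots> \<le> ennreal ((1 + L) ^ CARD('m)) * (ennreal (unit_ball_vol (real CARD('m)) * real CARD('m) ^ CARD('m)) * emeasure lborel S)"
    using hausdorff_measure_le_lborel[OF assms(1,2)] by (intro mult_left_mono) auto
  finally show ?thesis .
qed

section \<open>Areas of perturbed families of graphs\<close>

text \<open>All that the areas require of the eigenvalues. Uniform closeness of \<open>h n j\<close>
  to \<open>f j\<close> is demanded on \<open>U\<close>, but closeness in the Lipschitz sense only
  on each \<open>E g\<close>, from an \<open>n\<close> on that may depend on
  \<open>g\<close>.\<close>

locale perturbed_graphs =
  fixes U :: "(real^'m) set" and J :: "nat set" and f :: "nat \<Rightarrow> real^'m \<Rightarrow> real"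
    and h :: "nat \<Rightarrow> nat \<Rightarrow> real^'m \<Rightarrow> real" and E :: "real \<Rightarrow> (real^'m) set" and L :: real
  defines "E g \<equiv> {x \<in> U. \<forall>i\<in>J. \<forall>k\<in>J. f i x = f k x \<or> g \<le> \<bar>f i x - f k x\<bar>}"
  assumes U: "open U" "bounded U" and J: "finite J" and L: "0 \<le> L"
    and f_lip: "j \<in> J \<Longrightarrow> x \<in> U \<Longrightarrow> y \<in> U \<Longrightarrow> \<bar>f j x - f j y\<bar> \<le> L * dist x y"
    and h_lip: "eventually (\<lambda>n. \<forall>j\<in>J. \<forall>x\<in>U. \<forall>y\<in>U. \<bar>h n j x - h n j y\<bar> \<le> L * dist x y) sequentially"
    and unif: "0 < e \<Longrightarrow> eventually (\<lambda>n. \<forall>j\<in>J. \<forall>x\<in>U. \<bar>h n j x - f j x\<bar> \<le> e) sequentially"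
    and lip_diff: "0 < g \<Longrightarrow> 0 < e \<Longrightarrow> eventually (\<lambda>n. \<forall>j\<in>J. \<forall>x\<in>E g. \<forall>y\<in>E g.
        \<bar>(h n j x - f j x) - (h n j y - f j y)\<bar> \<le> e * dist x y) sequentially"
begin

definition gap :: "nat \<Rightarrow> real" where "gap p = 1 / real (Suc p)"

text \<open>Bounds the area over the exceptional set for every function with Lipschitz constant
  \<open>L\<close> on \<open>U\<close>, so one quantity serves the limit and all large
  \<open>n\<close>.\<close>

definition err :: "nat \<Rightarrow> ennreal" where
  "err p = ennreal ((1 + L) ^ CARD('m)) *
     (ennreal (unit_ball_vol (real CARD('m)) * real CARD('m) ^ CARD('m)) * emeasure lborel (U - E (gap p)))"

lemma gap_pos: "0 < gap p"
  by (simp add: gap_def)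

lemma E_subset: "E g \<subseteq> U"
  by (auto simp: E_def)

text \<open>The comparison with Lebesgue measure is for open sets. A point of \<open>U\<close> is
  outside \<open>E g\<close> exactly if some difference of values lies in a punctured interval
  around 0, an open condition.\<close>

lemma open_diff_E: "open (U - E g)"
proof -
  have cont: "continuous_on U (f j)" if "j \<in> J" for j
  proof (rule continuous_on_subset[OF lipschitz_on_continuous_on])
    show "L-lipschitz_on U (f j)"
      using f_lip[OF that] L by (auto simp: lipschitz_on_def dist_real_def)
  qed simp
  have "U - E g = (\<Union>i\<in>J. \<Union>k\<in>J. U \<inter> (\<lambda>x. f i x - f k x) -` {y. y \<noteq> 0 \<and> \<not> g \<le> \<bar>y\<bar>})"
    by (auto simp: E_def)
  also have "{y. y \<noteq> 0 \<and> \<not> g \<le> \<bar>y\<bar>} = {-g<..<g} - {0}" by auto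
  also have "open (\<Union>i\<in>J. \<Union>k\<in>J. U \<inter> (\<lambda>x. f i x - f k x) -` ({-g<..<g} - {0}))"
    by (intro open_UN ballI continuous_open_preimage continuous_on_diff cont U(1) open_Diff) auto
  finally show ?thesis .
qed

text \<open>Continuity of Lebesgue measure from above: at each point the finitely many nonzero
  differences have a positive minimum, so no point of \<open>U\<close> is exceptional for every
  \<open>p\<close>.\<close>

lemma err_tendsto: "err \<longlonglongrightarrow> 0"
proof -
  have "(\<lambda>p. emeasure lborel (U - E (gap p))) \<longlonglongrightarrow> emeasure lborel (\<Inter>p. U - E (gap p))"
  proof (rule Lim_emeasure_decseq)
    show "range (\<lambda>p. U - E (gap p)) \<subseteq> sets lborel" using open_diff_E by auto
    have "gap q \<le> gap p" if "p \<le> q" for p q using that by (simp add: gap_def frac_le)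
    then have "E (gap p) \<subseteq> E (gap q)" if "p \<le> q" for p q
      using that order_trans[of "gap q" "gap p"] unfolding E_def by blast
    then show "decseq (\<lambda>p. U - E (gap p))" by (simp add: decseq_def Diff_mono)
    have "bounded (U - E (gap p))" for p by (rule bounded_subset[OF U(2)]) auto
    then show "emeasure lborel (U - E (gap p)) \<noteq> \<infinity>" for p
      using emeasure_bounded_finite by (metis infinity_ennreal_def less_irrefl)
  qed
  moreover have "(\<Inter>p. U - E (gap p)) = {}"
  proof -
    have "\<exists>p. x \<in> E (gap p)" if x: "x \<in> U" for x
    proof -
      let ?D = "(\<lambda>(i, k). \<bar>f i x - f k x\<bar>) ` (J \<times> J) - {0}"
      \<comment> \<open>The inserted 1 keeps the set nonempty when all values coincide.\<close>
      have fin: "finite (insert 1 ?D)" using J by simp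
      define \<mu> where "\<mu> = Min (insert 1 ?D)"
      have "0 < \<mu>" unfolding \<mu>_def using fin by (subst Min_gr_iff) auto
      then obtain p where "gap p < \<mu>" using nat_approx_posE by (auto simp: gap_def)
      moreover have "\<mu> \<le> \<bar>f i x - f k x\<bar>" if "i \<in> J" "k \<in> J" "f i x \<noteq> f k x" for i k
        unfolding \<mu>_def using that by (intro Min_le[OF fin]) (auto intro!: image_eqI[of _ _ "(i, k)"])
      ultimately have "x \<in> E (gap p)" using x unfolding E_def by fastforce
      then show ?thesis ..
    qed
    then show ?thesis by blast
  qed
  ultimately have "(\<lambda>p. emeasure lborel (U - E (gap p))) \<longlonglongrightarrow> 0" by (simp only: emeasure_empty)
  then have "err \<longlonglongrightarrow> ennreal ((1 + L) ^ CARD('m)) *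
     (ennreal (unit_ball_vol (real CARD('m)) * real CARD('m) ^ CARD('m)) * 0)"
    unfolding err_def[abs_def] by (intro ennreal_tendsto_cmult) (auto intro!: ennreal_mult_less_top[THEN iffD2])
  then show ?thesis by simp
qed

lemma measure_graph_diff_E_le:
  assumes "\<And>x y. x \<in> U \<Longrightarrow> y \<in> U \<Longrightarrow> \<bar>u x - u y\<bar> \<le> L * dist x y"
  shows "hausdorff_measure CARD('m) (graph_map u ` (U - E (gap p))) \<le> err p"
  unfolding err_def
  by (rule hausdorff_measure_graph_le[OF open_diff_E bounded_subset[OF U(2)] L]) (use assms in auto)

text \<open>The graph of \<open>u\<close> over \<open>E (gap p)\<close> is an image of that of
  \<open>v\<close> under a map with Lipschitz constant \<open>1 + 4 * c\<close>; the rest costs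
  \<open>err p\<close>. Taking limit and perturbation in both orders gives both inequalities for the
  areas.\<close>

lemma Area_le:
  assumes u: "\<And>x y. x \<in> U \<Longrightarrow> y \<in> U \<Longrightarrow> \<bar>u x - u y\<bar> \<le> L * dist x y"
    and uv: "\<And>x y. x \<in> E (gap p) \<Longrightarrow> y \<in> E (gap p) \<Longrightarrow> \<bar>(u x - v x) - (u y - v y)\<bar> \<le> c * dist x y"
    and c: "0 \<le> c" "c \<le> 1 / 4" "(1 + 4 * c) ^ CARD('m) \<le> K"
  shows "Area U u \<le> ennreal K * Area U v + err p"
proof -
  have "Area U u \<le> hausdorff_measure CARD('m) (graph_map u ` E (gap p) \<union> graph_map u ` (U - E (gap p)))"
    unfolding Area_def by (rule hausdorff_measure_mono) auto
  also have "\<dots> \<le> hausdorff_measure CARD('m) (graph_map u ` E (gap p)) + err p"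
    by (rule order_trans[OF hausdorff_measure_Un add_left_mono[OF measure_graph_diff_E_le[OF u]]])
  also have "hausdorff_measure CARD('m) (graph_map u ` E (gap p)) \<le> ennreal ((1 + 4 * c) ^ CARD('m)) * hausdorff_measure CARD('m) (graph_map v ` E (gap p))"
  proof (rule hausdorff_measure_expanding)
    fix x y assume xy: "x \<in> E (gap p)" "y \<in> E (gap p)"
    have "\<bar>u x - u y - (v x - v y)\<bar> = \<bar>(u x - v x) - (u y - v y)\<bar>" by simp
    also have "\<dots> \<le> c * dist x y" by (rule uv[OF xy])
    also have "\<dots> \<le> c * (dist x y + \<bar>u x - u y\<bar>)" using c(1) by (intro mult_left_mono) auto
    finally show "dist (graph_map u x) (graph_map u y) \<le> (1 + 4 * c) * dist (graph_map v x) (graph_map v y)"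
      unfolding graph_map_def by (rule dist_Pair_real_perturb_le[OF _ c(1,2)])
  qed (use c(1) in simp)
  also have "\<dots> \<le> ennreal K * Area U v"
    unfolding Area_def using c(3) E_subset by (intro mult_mono ennreal_leI hausdorff_measure_mono) auto
  finally show ?thesis by (simp add: add_right_mono)
qed

lemma Area_tendsto:
  assumes j: "j \<in> J"
  shows "(\<lambda>n. Area U (h n j)) \<longlonglongrightarrow> Area U (f j)"
proof -
  have ev: "eventually (\<lambda>n. Area U (f j) \<le> ennreal K * Area U (h n j) + err p \<and>
      Area U (h n j) \<le> ennreal K * Area U (f j) + err p) sequentially" if K: "1 < K" for p K
  proof -
    obtain e where e: "0 < e" "e \<le> 1 / 4" "(1 + 4 * e) ^ CARD('m) \<le> K"
      using ex_small_power_le[OF K zero_less_one] by (metis mult_1)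
    from h_lip lip_diff[OF gap_pos[of p] e(1)] show ?thesis
    proof eventually_elim
      case (elim n)
      have "Area U (f j) \<le> ennreal K * Area U (h n j) + err p"
      proof (rule Area_le[where c = e])
        fix x y assume "x \<in> E (gap p)" "y \<in> E (gap p)"
        then have "\<bar>(h n j x - f j x) - (h n j y - f j y)\<bar> \<le> e * dist x y" using elim(2) j by blast
        then show "\<bar>(f j x - h n j x) - (f j y - h n j y)\<bar> \<le> e * dist x y" by linarith
      qed (use f_lip j e in auto)
      moreover have "Area U (h n j) \<le> ennreal K * Area U (f j) + err p"
        by (rule Area_le[where c = e]) (use elim j e in auto)
      ultimately show ?case ..
    qed
  qed
  have "Area U (f j) \<le> liminf (\<lambda>n. Area U (h n j))"
  proof (rule ennreal_le_liminf_of_approx[OF _ err_tendsto])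
    show "eventually (\<lambda>n. Area U (f j) \<le> ennreal K * Area U (h n j) + err p) sequentially" if "1 < K" for p K
      using ev[OF that, of p] by (rule eventually_mono) simp
  qed
  moreover have "limsup (\<lambda>n. Area U (h n j)) \<le> Area U (f j)"
  proof (rule ennreal_limsup_le_of_approx[OF _ err_tendsto])
    show "eventually (\<lambda>n. Area U (h n j) \<le> ennreal K * Area U (f j) + err p) sequentially" if "1 < K" for p K
      using ev[OF that, of p] by (rule eventually_mono) simp
  qed
  moreover have "liminf (\<lambda>n. Area U (h n j)) \<le> limsup (\<lambda>n. Area U (h n j))"
    by (rule Liminf_le_Limsup) simp
  ultimately show ?thesis
    by (auto simp: tendsto_iff_Liminf_eq_Limsup intro: antisym)
qed

text \<open>For a union, distances between points on different graphs have to be compared too. Two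
  points are far apart horizontally, or on the same graph, or vertically at least
  \<open>g / 2\<close> apart. In the first and last case the distance absorbs the sup bound
  \<open>2 * e\<close>; each case yields one summand of \<open>c\<close>.\<close>

lemma measure_union_graphs_E_le:
  assumes "0 < g" and uf: "\<And>j x. j \<in> J \<Longrightarrow> x \<in> U \<Longrightarrow> \<bar>u j x - f j x\<bar> \<le> e"
    and diff: "\<And>j x y. j \<in> J \<Longrightarrow> x \<in> E g \<Longrightarrow> y \<in> E g \<Longrightarrow> \<bar>(u j x - f j x) - (u j y - f j y)\<bar> \<le> e * dist x y"
    and c: "c = (1 + 8 * (L + 1) / g + 4 / g) * e" "0 < e" "c \<le> 1 / 4"
  shows "hausdorff_measure CARD('m) (\<Union>j\<in>J. graph_map (f j) ` E g)
    \<le> ennreal ((1 + 4 * c) ^ CARD('m)) * hausdorff_measure CARD('m) (\<Union>j\<in>J. graph_map (u j) ` U)"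
proof -
  \<comment> \<open>Only the lowest of several coinciding graphs is compared with its perturbation: the
    perturbations of coinciding graphs may split and are close to each other only in the sup norm.\<close>
  define I where "I = {(x, j). x \<in> E g \<and> j \<in> J \<and> (\<forall>i\<in>J. i < j \<longrightarrow> f i x \<noteq> f j x)}"
  define G where "G v = (\<lambda>(x, j). graph_map (v j) x)" for v :: "nat \<Rightarrow> real^'m \<Rightarrow> real"
  have "0 \<le> c" using \<open>0 < g\<close> L c(1,2) by simp
  have *: "\<bar>(f i x - f j y) - (u i x - u j y)\<bar> \<le> c * (dist x y + \<bar>f i x - f j y\<bar>)"
    if "(x, i) \<in> I" "(y, j) \<in> I" for x y i j
  proof -
    have xy: "x \<in> E g" "y \<in> E g" "i \<in> J" "j \<in> J" "x \<in> U" "y \<in> U"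
      using that E_subset by (auto simp: I_def)
    let ?l = "\<bar>(f i x - f j y) - (u i x - u j y)\<bar>"
    have l2: "?l \<le> 2 * e" using uf[OF xy(3,5)] uf[OF xy(4,6)] by linarith
    have "?l \<le> e * dist x y \<or> ?l \<le> (8 * (L + 1) / g * e) * dist x y \<or> ?l \<le> (4 / g * e) * \<bar>f i x - f j y\<bar>"
    proof (cases "g / (4 * (L + 1)) \<le> dist x y")
      case True
      have eq: "2 * e = (8 * M / g * e) * (g / (4 * M))" if "0 < M" for M
        using that \<open>0 < g\<close> by (simp add: field_simps)
      have "2 * e = (8 * (L + 1) / g * e) * (g / (4 * (L + 1)))" by (rule eq) (use L in simp)
      also have "\<dots> \<le> (8 * (L + 1) / g * e) * dist x y"
        using True \<open>0 < g\<close> L c(2) by (intro mult_left_mono) auto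
      finally show ?thesis using l2 by linarith
    next
      case False
      show ?thesis
      proof (cases "i = j")
        case True
        then show ?thesis using diff[OF xy(3) xy(1,2)] by (simp add: abs_if split: if_splits)
      next
        case ij: False
        have "(L + 1) * dist x y \<le> g / 4" using False \<open>0 < g\<close> L by (simp add: field_simps)
        then have near: "L * dist x y \<le> g / 4" by (simp add: distrib_right) (use zero_le_dist[of x y] in linarith)
        \<comment> \<open>The sheet with the larger index is the lowest one at its own point, so the
          two sheets are at least \<open>g\<close> apart there; the Lipschitz bound moves this to
          the other point at a cost of \<open>g / 4\<close>.\<close>
        have "g / 2 \<le> \<bar>f i x - f j y\<bar>"
        proof (cases "i < j")
          case True
          then have "f i y \<noteq> f j y" using that(2) xy by (auto simp: I_def)
          then have "g \<le> \<bar>f i y - f j y\<bar>" using xy by (auto simp: E_def)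
          then show ?thesis using f_lip[OF xy(3,5,6)] near \<open>0 < g\<close> by linarith
        next
          case False
          then have "f j x \<noteq> f i x" using that(1) ij xy by (auto simp: I_def)
          then have "g \<le> \<bar>f j x - f i x\<bar>" using xy by (auto simp: E_def)
          then show ?thesis using f_lip[OF xy(4,5,6)] near \<open>0 < g\<close> by linarith
        qed
        then have "(4 / g * e) * (g / 2) \<le> (4 / g * e) * \<bar>f i x - f j y\<bar>"
          using \<open>0 < g\<close> c(2) by (intro mult_left_mono) auto
        then show ?thesis using l2 \<open>0 < g\<close> by simp
      qed
    qed
    moreover have "e \<le> c" "8 * (L + 1) / g * e \<le> c" "4 / g * e \<le> c"
      using c(2) \<open>0 < g\<close> L by (simp_all add: c(1) distrib_right)
    then have "e * dist x y \<le> c * (dist x y + \<bar>f i x - f j y\<bar>)"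
      "(8 * (L + 1) / g * e) * dist x y \<le> c * (dist x y + \<bar>f i x - f j y\<bar>)"
      "(4 / g * e) * \<bar>f i x - f j y\<bar> \<le> c * (dist x y + \<bar>f i x - f j y\<bar>)"
      by (intro mult_mono; use \<open>0 \<le> c\<close> in simp)+
    ultimately show ?thesis by linarith
  qed
  have "(\<Union>j\<in>J. graph_map (f j) ` E g) \<subseteq> G f ` I"
  proof
    fix z assume "z \<in> (\<Union>j\<in>J. graph_map (f j) ` E g)"
    then obtain x j where xj: "x \<in> E g" "j \<in> J" and z: "z = graph_map (f j) x" by blast
    define i where "i = (LEAST i. i \<in> J \<and> f i x = f j x)"
    have "i \<in> J \<and> f i x = f j x" unfolding i_def by (rule LeastI) (use xj in simp)
    moreover have "f k x \<noteq> f i x" if "k \<in> J" "k < i" for k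
      using not_less_Least[of k "\<lambda>i. i \<in> J \<and> f i x = f j x"] that calculation by (auto simp: i_def)
    ultimately show "z \<in> G f ` I"
      using xj z by (intro image_eqI[of _ _ "(x, i)"]) (auto simp: I_def G_def graph_map_def)
  qed
  then have "hausdorff_measure CARD('m) (\<Union>j\<in>J. graph_map (f j) ` E g) \<le> hausdorff_measure CARD('m) (G f ` I)"
    by (rule hausdorff_measure_mono)
  also have "\<dots> \<le> ennreal ((1 + 4 * c) ^ CARD('m)) * hausdorff_measure CARD('m) (G u ` I)"
  proof (rule hausdorff_measure_expanding)
    fix a b assume "a \<in> I" "b \<in> I"
    then show "dist (G f a) (G f b) \<le> (1 + 4 * c) * dist (G u a) (G u b)"
      using dist_Pair_real_perturb_le[OF * \<open>0 \<le> c\<close> c(3)]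
      by (cases a, cases b) (simp add: G_def graph_map_def)
  qed (use \<open>0 \<le> c\<close> in simp)
  also have "\<dots> \<le> ennreal ((1 + 4 * c) ^ CARD('m)) * hausdorff_measure CARD('m) (\<Union>j\<in>J. graph_map (u j) ` U)"
  proof (intro mult_left_mono hausdorff_measure_mono)
    show "G u ` I \<subseteq> (\<Union>j\<in>J. graph_map (u j) ` U)" using E_subset by (auto simp: G_def I_def)
  qed simp
  finally show ?thesis .
qed

text \<open>Over \<open>E (gap p)\<close> the unions are compared directly; over the rest each of
  the \<open>card J\<close> graphs costs at most \<open>err p\<close>. The comparison is one-sided,
  as coinciding graphs may split under perturbation.\<close>

lemma measure_union_graphs_liminf:
  "hausdorff_measure CARD('m) (\<Union>j\<in>J. graph_map (f j) ` U)
    \<le> liminf (\<lambda>n. hausdorff_measure CARD('m) (\<Union>j\<in>J. graph_map (h n j) ` U))"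
proof (rule ennreal_le_liminf_of_approx)
  show "(\<lambda>p. ennreal (real (card J)) * err p) \<longlonglongrightarrow> 0"
    using ennreal_tendsto_cmult[OF _ err_tendsto, of "ennreal (real (card J))"] by simp
next
  fix p and K :: real assume "1 < K"
  let ?g = "gap p" and ?C = "1 + 8 * (L + 1) / gap p + 4 / gap p"
  have "0 < ?C" using L gap_pos[of p] by (simp add: add_pos_nonneg)
  then obtain e where e: "0 < e" "?C * e \<le> 1 / 4" "(1 + 4 * (?C * e)) ^ CARD('m) \<le> K"
    using ex_small_power_le[OF \<open>1 < K\<close>] by blast
  from unif[OF e(1)] lip_diff[OF gap_pos[of p] e(1)]
  show "eventually (\<lambda>n. hausdorff_measure CARD('m) (\<Union>j\<in>J. graph_map (f j) ` U)
    \<le> ennreal K * hausdorff_measure CARD('m) (\<Union>j\<in>J. graph_map (h n j) ` U) + ennreal (real (card J)) * err p) sequentially"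
  proof eventually_elim
    case (elim n)
    let ?H = "hausdorff_measure CARD('m) :: ((real^'m) \<times> real) set \<Rightarrow> ennreal"
    have "?H (\<Union>j\<in>J. graph_map (f j) ` U) \<le> ?H ((\<Union>j\<in>J. graph_map (f j) ` E ?g) \<union> (\<Union>j\<in>J. graph_map (f j) ` (U - E ?g)))"
      by (rule hausdorff_measure_mono) auto
    also have "\<dots> \<le> ?H (\<Union>j\<in>J. graph_map (f j) ` E ?g) + ?H (\<Union>j\<in>J. graph_map (f j) ` (U - E ?g))"
      by (rule hausdorff_measure_Un)
    also have "\<dots> \<le> ennreal K * ?H (\<Union>j\<in>J. graph_map (h n j) ` U) + ennreal (real (card J)) * err p"
    proof (rule add_mono)
      have "?H (\<Union>j\<in>J. graph_map (f j) ` E ?g) \<le> ennreal ((1 + 4 * (?C * e)) ^ CARD('m)) * ?H (\<Union>j\<in>J. graph_map (h n j) ` U)"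
        using elim by (intro measure_union_graphs_E_le[OF gap_pos _ _ refl e(1,2)]) auto
      also have "\<dots> \<le> ennreal K * ?H (\<Union>j\<in>J. graph_map (h n j) ` U)"
        using e(3) by (intro mult_right_mono ennreal_leI) auto
      finally show "?H (\<Union>j\<in>J. graph_map (f j) ` E ?g) \<le> ennreal K * ?H (\<Union>j\<in>J. graph_map (h n j) ` U)" .
      have "?H (\<Union>j\<in>J. graph_map (f j) ` (U - E ?g)) \<le> (\<Sum>j\<in>J. ?H (graph_map (f j) ` (U - E ?g)))"
        by (rule hausdorff_measure_UN_le[OF J])
      also have "\<dots> \<le> (\<Sum>j\<in>J. err p)"
        by (intro sum_mono measure_graph_diff_E_le f_lip)
      finally show "?H (\<Union>j\<in>J. graph_map (f j) ` (U - E ?g)) \<le> ennreal (real (card J)) * err p"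
        by (simp add: ennreal_of_nat_eq_real_of_nat)
    qed
    finally show ?case .
  qed
qed

end

section \<open>Application to the eigenvalues\<close>

lemma C01_norm_bounds:
  assumes "C01_norm U f \<le> ennreal e" "0 \<le> e"
  shows "x \<in> U \<Longrightarrow> norm (f x) \<le> e"
    and "x \<in> U \<Longrightarrow> y \<in> U \<Longrightarrow> norm (f x - f y) \<le> e * norm (x - y)"
proof -
  show "norm (f x) \<le> e" if "x \<in> U"
  proof -
    have "ennreal (norm (f x)) \<le> (SUP x\<in>U. ennreal (norm (f x)))" by (rule SUP_upper[OF that])
    also have "\<dots> \<le> C01_norm U f" by (simp add: C01_norm_def)
    finally show ?thesis using assms by (metis ennreal_le_iff order_trans)
  qed
  show "norm (f x - f y) \<le> e * norm (x - y)" if "x \<in> U" "y \<in> U"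
  proof (cases "x = y")
    case False
    let ?S = "{(x, y). x \<in> U \<and> y \<in> U \<and> x \<noteq> y}" and ?q = "\<lambda>(x, y). ennreal (norm (f x - f y) / norm (x - y))"
    have "?q (x, y) \<le> (SUP p\<in>?S. ?q p)" by (rule SUP_upper) (use that False in simp)
    also have "\<dots> \<le> C01_norm U f" by (simp add: C01_norm_def)
    finally have "ennreal (norm (f x - f y) / norm (x - y)) \<le> ennreal e" using assms(1) by simp
    then show ?thesis using assms(2) False by (simp add: divide_le_eq)
  qed simp
qed

theorem theorem1p20:
  fixes U :: "(real^'m) set"
    and A :: "real^'m \<Rightarrow> complex^'d^'d"
    and An :: "nat \<Rightarrow> real^'m \<Rightarrow> complex^'d^'d"
    and lam :: "nat \<Rightarrow> real^'m \<Rightarrow> real"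
    and lamn :: "nat \<Rightarrow> nat \<Rightarrow> real^'m \<Rightarrow> real"
    and Z :: "((real^'m) \<times> real) set"
    and Zn :: "nat \<Rightarrow> ((real^'m) \<times> real) set"
  assumes "open U" and "bounded U"
    and "A \<in> C01 U Herm"
    and "\<And>n. An n \<in> C01 U Herm"
    and "(\<lambda>n. C01_norm U (\<lambda>x. An n x - A x)) \<longlonglongrightarrow> 0"
    and "\<And>j. lam j = eigval_up j \<circ> A"
    and "\<And>n j. lamn n j = eigval_up j \<circ> An n"
    and "Z = (\<Union>j\<in>{1..CARD('d)}. graph_map (lam j) ` U)"
    and "\<And>n. Zn n = (\<Union>j\<in>{1..CARD('d)}. graph_map (lamn n j) ` U)"
  shows "(\<forall>j\<in>{1..CARD('d)}. (\<lambda>n. Area U (lamn n j)) \<longlonglongrightarrow> Area U (lam j)) \<and>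
         liminf (\<lambda>n. hausdorff_measure CARD('m) (Zn n)) \<ge> hausdorff_measure CARD('m) Z"
proof -
  let ?J = "{1..CARD('d)}"
  have HA: "A x \<in> Herm" if "x \<in> U" for x
    using assms(3) closure_subset that unfolding C01_def by blast
  have HAn: "An n x \<in> Herm" if "x \<in> U" for n x
    using assms(4) closure_subset that unfolding C01_def by blast
  have "C01_norm U A < top" using assms(3) by (simp add: C01_def)
  then obtain M where M: "0 \<le> M" "C01_norm U A = ennreal M" by (auto simp: less_top[symmetric] elim: ennreal_cases)
  have A_bd: "norm (A x) \<le> M" if "x \<in> U" for x
    using C01_norm_bounds(1)[of U A M] M that by simp
  have A_lip: "norm (A x - A y) \<le> M * norm (x - y)" if "x \<in> U" "y \<in> U" for x y
    using C01_norm_bounds(2)[of U A M] M that by simp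
  have ev: "eventually (\<lambda>n. C01_norm U (\<lambda>x. An n x - A x) \<le> ennreal e) sequentially" if "0 < e" for e
    using order_tendstoD(2)[OF assms(5), of "ennreal e"] that by (auto elim: eventually_mono)
  define E where "E g = {x \<in> U. \<forall>i\<in>?J. \<forall>k\<in>?J. lam i x = lam k x \<or> g \<le> \<bar>lam i x - lam k x\<bar>}" for g
  \<comment> \<open>The Lipschitz constant \<open>M\<close> of \<open>A\<close> is enlarged by 1 to
    cover \<open>An n\<close> as soon as its \<open>C01_norm\<close> distance to \<open>A\<close> is
    at most 1.\<close>
  have pg: "perturbed_graphs U ?J lam lamn (M + 1)"
  proof
    show "\<bar>lam j x - lam j y\<bar> \<le> (M + 1) * dist x y" if "j \<in> ?J" "x \<in> U" "y \<in> U" for j x y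
    proof -
      have "\<bar>lam j x - lam j y\<bar> \<le> norm (A x - A y)"
        unfolding assms(6) o_def by (rule eigval_up_lipschitz[OF HA HA]) (use that in auto)
      also have "\<dots> \<le> M * norm (x - y)" by (rule A_lip[OF that(2,3)])
      also have "\<dots> \<le> (M + 1) * dist x y" by (simp add: dist_norm distrib_right)
      finally show ?thesis .
    qed
    show "eventually (\<lambda>n. \<forall>j\<in>?J. \<forall>x\<in>U. \<forall>y\<in>U. \<bar>lamn n j x - lamn n j y\<bar> \<le> (M + 1) * dist x y) sequentially"
      using ev[OF zero_less_one]
    proof eventually_elim
      case (elim n)
      show ?case
      proof (intro ballI)
        fix j x y assume j: "j \<in> ?J" and xy: "x \<in> U" "y \<in> U"
        have "\<bar>lamn n j x - lamn n j y\<bar> \<le> norm (An n x - An n y)"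
          unfolding assms(7) o_def by (rule eigval_up_lipschitz[OF HAn HAn]) (use j xy in auto)
        also have "An n x - An n y = (A x - A y) + ((An n x - A x) - (An n y - A y))" by simp
        also have "norm \<dots> \<le> M * norm (x - y) + 1 * norm (x - y)"
          by (rule norm_triangle_le, rule add_mono[OF A_lip[OF xy] C01_norm_bounds(2)[OF elim _ xy]]) simp
        finally show "\<bar>lamn n j x - lamn n j y\<bar> \<le> (M + 1) * dist x y" by (simp add: dist_norm distrib_right)
      qed
    qed
    show "eventually (\<lambda>n. \<forall>j\<in>?J. \<forall>x\<in>U. \<bar>lamn n j x - lam j x\<bar> \<le> e) sequentially" if "0 < e" for e
      using ev[OF that]
    proof eventually_elim
      case (elim n)
      show ?case
      proof (intro ballI)
        fix j x assume j: "j \<in> ?J" and x: "x \<in> U"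
        have "\<bar>lamn n j x - lam j x\<bar> \<le> norm (An n x - A x)"
          unfolding assms(6,7) o_def by (rule eigval_up_lipschitz[OF HAn HA]) (use j x in auto)
        also have "\<dots> \<le> e" by (rule C01_norm_bounds(1)[OF elim _ x]) (use that in simp)
        finally show "\<bar>lamn n j x - lam j x\<bar> \<le> e" .
      qed
    qed
    fix g e :: real assume "0 < g" "0 < e"
    have "eventually (\<lambda>n. \<forall>x\<in>E g. \<forall>y\<in>E g.
        \<bar>(lamn n j x - lam j x) - (lamn n j y - lam j y)\<bar> \<le> e * dist x y) sequentially" if j: "j \<in> ?J" for j
    proof -
      have EU: "E g \<subseteq> U" by (auto simp: E_def)
      have HE: "A ` E g \<subseteq> Herm" using EU HA by blast
      have bdE: "norm (A x) \<le> M" if "x \<in> E g" for x using A_bd that EU by blast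
      have lipE: "norm (A x - A y) \<le> M * norm (x - y)" if "x \<in> E g" "y \<in> E g" for x y using A_lip that EU by blast
      have gapE: "eigval_gap g (eigval_up j (A x)) (A x)" if "x \<in> E g" for x
        using that j unfolding E_def eigval_gap_def assms(6) o_def by blast
      from eigval_up_difference_lipschitz[OF j \<open>0 < g\<close> HE bdE lipE gapE]
      obtain C where C: "0 < C"
        "\<And>A' \<epsilon>. A' ` E g \<subseteq> Herm \<Longrightarrow> \<forall>x\<in>E g. norm (A' x - A x) \<le> \<epsilon> \<Longrightarrow>
          \<forall>x\<in>E g. \<forall>y\<in>E g. norm ((A' x - A x) - (A' y - A y)) \<le> \<epsilon> * norm (x - y) \<Longrightarrow>
          \<forall>x\<in>E g. \<forall>y\<in>E g. \<bar>(eigval_up j (A' x) - eigval_up j (A x)) - (eigval_up j (A' y) - eigval_up j (A y))\<bar>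
            \<le> C * \<epsilon> * norm (x - y)"
        by blast
      \<comment> \<open>\<open>C\<close> does not depend on the perturbation, so a distance of at
        most \<open>e / C\<close> yields the required \<open>e\<close>.\<close>
      have "0 < e / C" using C(1) \<open>0 < e\<close> by simp
      from ev[OF this] show ?thesis
      proof eventually_elim
        case (elim n)
        note bd = C01_norm_bounds[OF elim less_imp_le[OF \<open>0 < e / C\<close>]]
        have "\<forall>x\<in>E g. \<forall>y\<in>E g. \<bar>(eigval_up j (An n x) - eigval_up j (A x)) - (eigval_up j (An n y) - eigval_up j (A y))\<bar>
            \<le> C * (e / C) * norm (x - y)"
        proof (rule C(2))
          show "An n ` E g \<subseteq> Herm" using EU HAn by blast
          show "\<forall>x\<in>E g. norm (An n x - A x) \<le> e / C" using bd(1) EU by blast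
          show "\<forall>x\<in>E g. \<forall>y\<in>E g. norm ((An n x - A x) - (An n y - A y)) \<le> e / C * norm (x - y)"
            using bd(2) EU by blast
        qed
        then show ?case using C(1) by (simp add: assms(6,7) dist_norm)
      qed
    qed
    then have all: "\<forall>j\<in>?J. eventually (\<lambda>n. \<forall>x\<in>E g. \<forall>y\<in>E g.
        \<bar>(lamn n j x - lam j x) - (lamn n j y - lam j y)\<bar> \<le> e * dist x y) sequentially" by blast
    show "eventually (\<lambda>n. \<forall>j\<in>?J.
        \<forall>x\<in>{x \<in> U. \<forall>i\<in>?J. \<forall>k\<in>?J. lam i x = lam k x \<or> g \<le> \<bar>lam i x - lam k x\<bar>}.
        \<forall>y\<in>{x \<in> U. \<forall>i\<in>?J. \<forall>k\<in>?J. lam i x = lam k x \<or> g \<le> \<bar>lam i x - lam k x\<bar>}.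
        \<bar>(lamn n j x - lam j x) - (lamn n j y - lam j y)\<bar> \<le> e * dist x y) sequentially"
      unfolding E_def[symmetric] by (rule eventually_ball_finite[OF finite_atLeastAtMost all])
  qed (use assms M in auto)
  show ?thesis
    unfolding assms(8,9)
    using perturbed_graphs.Area_tendsto[OF pg] perturbed_graphs.measure_union_graphs_liminf[OF pg] by blast
qed

end
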